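(* Let $f:\mathbb{R}^n\to\mathbb{R}$ be twice continuously differentiable, with $L_g$-Lipschitz continuous gradient and $L_H$-Lipschitz continuous Hessian on $\mathbb{R}^n$, and bounded below by a scalar $\bar f\in\mathbb{R}$. Let the Stochastic Two-Step Method (defined in the context) be run under the stochastic conditions (A), (B), (C) stated in the context, with parameters $\gamma\in(0,1]$, $\gamma_H\in[0,\gamma)$, $\gamma_\lambda\in[0,1)$, $\gamma_H<\gamma(1-\gamma_\lambda)$, $\delta\in(0,\infty)$, constant $\theta_k=\theta\in[0,1)$ and $\hat\theta_k=\hat\theta\in[0,\infty)$, and $\sigma_k>0$, $\hat\sigma_k>0$ with $$\sum_{k=0}^\infty\sigma_k^2<\infty\qquad\text{and}\qquad\sum_{k=0}^\infty\hat\sigma_k^2<\infty.$$ Let the step sizes be constant, $\alpha_k=\alpha$ and $\beta_k=\beta$, with $$0<\alpha\le\frac{1}{L_g(1+\hat\theta^2)}\qquad\text{and}\qquad 0<\beta\le\frac{3\left(\gamma-\frac{\gamma_H}{1-\gamma_\lambda}\right)}{2\delta L_H}.$$ Then the iterates generated by the method satisfy $$\lim_{k\to\infty}\mathbb{E}[\|\nabla f(x_k)\|_2]=0\qquad\text{and}\qquad\liminf_{k\to\infty}\mathbb{E}[\lambda_{\min}(\nabla^2 f(x_k))]\ge0.$$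
   Context: Setting: $f(x)=\mathbb{E}_\xi[F(x,\xi)]$ for a random variable $\xi$; only stochastic approximations of the gradient and Hessian are available. $\lambda_{\min}(A)$ denotes the left-most (smallest) eigenvalue of a symmetric matrix $A$. $\mathbb{N}=\{0,1,2,\dots\}$. Stochastic Two-Step Method. Given $x_0\in\mathbb{R}^n$ and step sizes $\alpha_k>0$, $\beta_k>0$, for $k=0,1,2,\dots$: 1. Compute a (symmetric, random) Hessian approximation $H_k$ of $\nabla^2 f(x_k)$, with left-most eigenvalue $\lambda_k$, such that condition (B) holds. If $\lambda_k\ge0$ set $p_k=0$; otherwise compute $q_k$ and set $p_k$ using condition (A). 2. Set $\hat x_k=x_k+\beta_kp_k$. 3. Compute a (random) gradient approximation $\hat g_k$ at $\hat x_k$ satisfying condition (C), and set $d_k=-\hat g_k$. 4. Set $x_{k+1}=\hat x_k+\alpha_kd_k=x_k+\beta_kp_k+\alpha_kd_k$. There is no termination test. Conditional expectations: $\mathcal{F}_k=\sigma(x_0,\dots,x_k)$, $\mathbb{E}_k[\cdot]=\mathbb{E}[\cdot\mid\mathcal{F}_k]$, $\mathbb{E}_{\hat k}[\cdot]=\mathbb{E}[\cdot\mid\mathcal{F}_k,\hat x_k]$, $\mathbb{E}_{k,q}[\cdot]=\mathbb{E}[\cdot\mid\mathcal{F}_k,q_k]$; $\mathbb{E}$ is the total expectation. Write $\lambda_k^-:=\min\{\lambda_k,0\}$ and $\lambda_{\min,k}^-:=\min\{\lambda_{\min}(\nabla^2 f(x_k)),0\}$. Conditions, required for all $k\in\mathbb{N}$: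 (A) If $\lambda_k\ge0$, then $p_k=0$ (and one takes $q_k=0$). Otherwise $p_k=q_k$ if $g_k^{\mathsf T}q_k\le0$ and $p_k=-q_k$ otherwise, where $q_k$ satisfies $q_k^{\mathsf T}H_kq_k\le\gamma\lambda_k\|q_k\|_2^2<0$ and $\|q_k\|_2=\delta|\lambda_k|$. The (random) approximation $g_k$ of $\nabla f(x_k)$ satisfies $\mathbb{E}_{k,q}[|(g_k-\nabla f(x_k))^{\mathsf T}q_k|]\le\theta_k^2\,\mathbb{E}_{k,q}[|g_k^{\mathsf T}q_k|]+\sigma_k^2$. (B) $\mathbb{E}_k[\|(H_k-\nabla^2 f(x_k))p_k\|_2^2]\le\gamma_H^2|\lambda_{\min,k}^-|^2\,\mathbb{E}_k[\|p_k\|_2^2]$ and $\mathbb{E}_k[|\lambda_k^--\lambda_{\min,k}^-|]\le\gamma_\lambda|\lambda_{\min,k}^-|$. (C) $\mathbb{E}_{\hat k}[\hat g_k]=\nabla f(\hat x_k)$ and $\mathbb{E}_{\hat k}[\|\hat g_k-\nabla f(\hat x_k)\|_2^2]\le\hat\theta_k^2\|\nabla f(\hat x_k)\|_2^2+\hat\sigma_k^2$. *)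

theory Defs
  imports "HOL-Analysis.Analysis" "HOL-Probability.Probability"
begin

definition grad :: "(real^'n \<Rightarrow> real) \<Rightarrow> real^'n \<Rightarrow> real^'n" where
  "grad f y = (THE D. GDERIV f y :> D)"

definition hess :: "(real^'n \<Rightarrow> real) \<Rightarrow> real^'n \<Rightarrow> real^'n^'n" where
  "hess f y = jacobian (grad f) (at y)"

definition twice_continuously_differentiable :: "(real^'n \<Rightarrow> real) \<Rightarrow> bool" where
  "twice_continuously_differentiable f \<longleftrightarrow>
     f differentiable_on UNIV \<and> grad f differentiable_on UNIV \<and> continuous_on UNIV (hess f)"

text \<open>The left-most eigenvalue. It is only meaningful when a least real eigenvalue exists,
  in particular for symmetric matrices.\<close>

definition min_eigenvalue :: "real^'n^'n \<Rightarrow> real" where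
  "min_eigenvalue A = (LEAST c. \<exists>v. v \<noteq> 0 \<and> A *v v = c *\<^sub>R v)"

text \<open>The \<open>\<sigma>\<close>-algebra on \<open>space M\<close> generated by a set \<open>X\<close> of random vectors.\<close>

definition generated_by :: "'a measure \<Rightarrow> ('a \<Rightarrow> real^'n) set \<Rightarrow> 'a measure" where
  "generated_by M X = sigma (space M) {Y -` B \<inter> space M |Y B. Y \<in> X \<and> B \<in> sets borel}"

text \<open>
  In the locale below, \<open>xh\<close>, \<open>gh\<close>, \<open>\<theta>h\<close> and \<open>\<sigma>h\<close> are the hatted quantities of the method,
  and \<open>\<gamma>\<^sub>l\<close> is the constant in the bound on the left-most eigenvalues \<open>\<lambda>\<^sub>k = min_eigenvalue (H k \<omega>)\<close>.
  Conditional expectations of nonnegative quantities are taken in \<^typ>\<open>ennreal\<close>, so that they exist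
  without integrability assumptions. In conditions (A) and (B) the right-hand side must then be
  finite almost surely, since otherwise the inequality would read \<open>_ \<le> \<infinity>\<close> and say nothing.
  In condition (C) nothing has to be added: the variance bound has a finite right-hand side,
  hence \<open>gh k\<close> has almost surely finite conditional first moments, and for such functions
  \<^const>\<open>real_cond_exp\<close> (the difference of the conditional expectations of the positive and
  negative parts) is the conditional expectation even without integrability.
\<close>

locale stochastic_two_step_method = prob_space M
  for M :: "'a measure" +
  fixes f :: "real^'n \<Rightarrow> real"
    and x0 :: "real^'n"
    and \<alpha> \<beta> :: "nat \<Rightarrow> real"
    and \<gamma> \<gamma>\<^sub>H \<gamma>\<^sub>l \<delta> :: real
    and \<theta> \<sigma> \<theta>h \<sigma>h :: "nat \<Rightarrow> real"
    and x xh p q g gh :: "nat \<Rightarrow> 'a \<Rightarrow> real^'n"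
    and H :: "nat \<Rightarrow> 'a \<Rightarrow> real^'n^'n"
  assumes random:
      "\<And>k. random_variable borel (H k)" "\<And>k. random_variable borel (q k)"
      "\<And>k. random_variable borel (g k)" "\<And>k. random_variable borel (gh k)"
    and H_symmetric: "\<And>k \<omega>. \<omega> \<in> space M \<Longrightarrow> transpose (H k \<omega>) = H k \<omega>"
    and initial: "\<And>\<omega>. \<omega> \<in> space M \<Longrightarrow> x 0 \<omega> = x0"
    and curvature_step: "\<And>k \<omega>. \<omega> \<in> space M \<Longrightarrow> xh k \<omega> = x k \<omega> + \<beta> k *\<^sub>R p k \<omega>"
    and gradient_step: "\<And>k \<omega>. \<omega> \<in> space M \<Longrightarrow> x (Suc k) \<omega> = xh k \<omega> + \<alpha> k *\<^sub>R (- gh k \<omega>)"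
    and A_nonneg: "\<And>k \<omega>. \<omega> \<in> space M \<Longrightarrow> min_eigenvalue (H k \<omega>) \<ge> 0 \<Longrightarrow> p k \<omega> = 0 \<and> q k \<omega> = 0"
    and A_neg: "\<And>k \<omega>. \<omega> \<in> space M \<Longrightarrow> min_eigenvalue (H k \<omega>) < 0 \<Longrightarrow>
      p k \<omega> = (if g k \<omega> \<bullet> q k \<omega> \<le> 0 then q k \<omega> else - q k \<omega>) \<and>
      q k \<omega> \<bullet> (H k \<omega> *v q k \<omega>) \<le> \<gamma> * min_eigenvalue (H k \<omega>) * (norm (q k \<omega>))\<^sup>2 \<and>
      \<gamma> * min_eigenvalue (H k \<omega>) * (norm (q k \<omega>))\<^sup>2 < 0 \<and>
      norm (q k \<omega>) = \<delta> * \<bar>min_eigenvalue (H k \<omega>)\<bar>"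
    and A_gradient: "\<And>k. let F = generated_by M (insert (q k) {x i |i. i \<le> k}) in
      AE \<omega> in M.
        nn_cond_exp M F (\<lambda>\<omega>. ennreal \<bar>g k \<omega> \<bullet> q k \<omega>\<bar>) \<omega> < \<infinity> \<and>
        nn_cond_exp M F (\<lambda>\<omega>. ennreal \<bar>(g k \<omega> - grad f (x k \<omega>)) \<bullet> q k \<omega>\<bar>) \<omega>
          \<le> ennreal ((\<theta> k)\<^sup>2) * nn_cond_exp M F (\<lambda>\<omega>. ennreal \<bar>g k \<omega> \<bullet> q k \<omega>\<bar>) \<omega> + ennreal ((\<sigma> k)\<^sup>2)"
    and B_hessian: "\<And>k. let F = generated_by M {x i |i. i \<le> k} in
      AE \<omega> in M.
        nn_cond_exp M F (\<lambda>\<omega>. ennreal ((norm (p k \<omega>))\<^sup>2)) \<omega> < \<infinity> \<and>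
        nn_cond_exp M F (\<lambda>\<omega>. ennreal ((norm ((H k \<omega> - hess f (x k \<omega>)) *v p k \<omega>))\<^sup>2)) \<omega>
          \<le> ennreal (\<gamma>\<^sub>H\<^sup>2 * \<bar>min (min_eigenvalue (hess f (x k \<omega>))) 0\<bar>\<^sup>2) *
            nn_cond_exp M F (\<lambda>\<omega>. ennreal ((norm (p k \<omega>))\<^sup>2)) \<omega>"
    and B_eigenvalue: "\<And>k. let F = generated_by M {x i |i. i \<le> k} in
      AE \<omega> in M.
        nn_cond_exp M F
          (\<lambda>\<omega>. ennreal \<bar>min (min_eigenvalue (H k \<omega>)) 0 - min (min_eigenvalue (hess f (x k \<omega>))) 0\<bar>) \<omega>
          \<le> ennreal (\<gamma>\<^sub>l * \<bar>min (min_eigenvalue (hess f (x k \<omega>))) 0\<bar>)"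
    and C_unbiased: "\<And>k i. let F = generated_by M (insert (xh k) {x i |i. i \<le> k}) in
      AE \<omega> in M. real_cond_exp M F (\<lambda>\<omega>. gh k \<omega> $ i) \<omega> = grad f (xh k \<omega>) $ i"
    and C_variance: "\<And>k. let F = generated_by M (insert (xh k) {x i |i. i \<le> k}) in
      AE \<omega> in M.
        nn_cond_exp M F (\<lambda>\<omega>. ennreal ((norm (gh k \<omega> - grad f (xh k \<omega>)))\<^sup>2)) \<omega>
          \<le> ennreal ((\<theta>h k)\<^sup>2 * (norm (grad f (xh k \<omega>)))\<^sup>2 + (\<sigma>h k)\<^sup>2)"

end

theory Submission
  imports Defs
begin

text \<open>
  The expected optimality gap \<open>E[f(x\<^sub>k) - fbar]\<close> decreases along the method, up to summable errors,
  and the amount of the decrease controls both optimality measures.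

  Write \<open>l\<^sub>k = |min {\<lambda>\<^sub>k, 0}|\<close> for the estimated negative curvature, so that \<open>\<parallel>p\<^sub>k\<parallel> = \<delta> l\<^sub>k\<close>. The cubic
  upper model of \<open>f\<close> at \<open>x\<^sub>k\<close> bounds the gap after the curvature step by the previous gap, plus
  \<open>\<beta> \<nabla>f\<cdot>p\<close>, plus \<open>\<beta>\<^sup>2/2 \<parallel>p\<parallel> \<parallel>(H - \<nabla>\<^sup>2f) p\<parallel>\<close>, minus a multiple of \<open>l\<^sub>k\<^sup>3\<close>. The choice of the sign of
  \<open>p\<close> and condition (A) make the expectation of \<open>\<nabla>f\<cdot>p\<close> at most \<open>\<sigma>\<^sub>k\<^sup>2\<close> (\<open>mean_grad_inner_p\<close>). By
  condition (B), the product term is in expectation at most \<open>\<gamma>\<^sub>H L \<parallel>p\<parallel>\<^sup>2\<close>, where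
  \<open>L = |min {\<lambda>\<^sub>m\<^sub>i\<^sub>n(\<nabla>\<^sup>2f), 0}|\<close> (\<open>mean_hess_error_p\<close>), and \<open>L\<close> itself is at most the conditional mean of
  \<open>l\<^sub>k / (1 - \<gamma>\<^sub>l)\<close>; a tangent-line argument then turns \<open>L l\<^sub>k\<^sup>2\<close> into \<open>l\<^sub>k\<^sup>3 / (1 - \<gamma>\<^sub>l)\<close>. The bound on \<open>\<beta>\<close> leaves a
  positive multiple of \<open>E[l\<^sub>k\<^sup>3]\<close> as decrease (\<open>curvature_step_decrease\<close>). The gradient step is
  the usual one for stochastic gradients: unbiasedness and the bound on \<open>\<alpha>\<close> leave a decrease of
  \<open>\<alpha>/2 E[\<parallel>\<nabla>f\<parallel>\<^sup>2]\<close> at the trial point (\<open>gradient_step_decrease\<close>).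

  Telescoping makes these decreases summable, so \<open>E[l\<^sub>k\<^sup>3]\<close> and the mean squared trial gradient
  tend to \<open>0\<close>, hence so do \<open>E[l\<^sub>k]\<close> and the mean norm of the trial gradient. The gradient at \<open>x\<^sub>k\<close>
  differs from that at the trial point by at most \<open>L\<^sub>g \<beta> \<delta> l\<^sub>k\<close>, and \<open>E[L] \<le> E[l\<^sub>k] / (1 - \<gamma>\<^sub>l)\<close>; this gives
  both limits.

  The delicate point is integrability. Conditions (A) and (B) only provide almost sure finiteness
  of conditional moments, and \<open>l\<^sub>k\<^sup>3\<close> is not known to be integrable beforehand. The estimates
  are therefore proved on events of the past on which the conditional moments are bounded; these
  events exhaust the space (\<open>nn_integral_le_by_localization\<close>).
\<close>

section \<open>The left-most eigenvalue of a symmetric matrix\<close>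

lemma symmetric_matrix_inner:
  fixes A :: "real^'n^'n"
  assumes "transpose A = A"
  shows "u \<bullet> (A *v v) = v \<bullet> (A *v u)"
  using dot_lmul_matrix[of u A v] assms
  by (metis inner_commute transpose_matrix_vector)

text \<open>
  A minimizer \<open>v\<close> of the quadratic form on the unit sphere is an eigenvector for the minimal
  value \<open>c\<close>: the form \<open>u \<bullet> A u - c |u|\<^sup>2\<close> is nonnegative and vanishes at \<open>v\<close>, so its first variation
  at \<open>v\<close> is zero. Every eigenvalue is a value of the form on the sphere, so \<open>c\<close> is the least one.
\<close>

lemma min_eigenvalue_rayleigh:
  fixes A :: "real^'n^'n"
  assumes sym: "transpose A = A"
  obtains v where "norm v = 1" "min_eigenvalue A = v \<bullet> (A *v v)"
    "\<And>u. min_eigenvalue A * (norm u)\<^sup>2 \<le> u \<bullet> (A *v u)"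
proof -
  have "continuous_on (sphere 0 1) (\<lambda>v. v \<bullet> (A *v v))"
    by (intro continuous_intros)
  moreover have "sphere (0::real^'n) 1 \<noteq> {}"
    by (simp add: sphere_eq_empty)
  ultimately obtain v where v: "norm v = 1"
    and min: "\<And>u. norm u = 1 \<Longrightarrow> v \<bullet> (A *v v) \<le> u \<bullet> (A *v u)"
    using continuous_attains_inf[of "sphere (0::real^'n) 1" "\<lambda>v. v \<bullet> (A *v v)"] by auto
  define c where "c = v \<bullet> (A *v v)"
  have le: "c * (norm u)\<^sup>2 \<le> u \<bullet> (A *v u)" for u
  proof (cases "u = 0")
    case False
    then have "c \<le> (u /\<^sub>R norm u) \<bullet> (A *v (u /\<^sub>R norm u))"
      unfolding c_def by (intro min) simp
    then show ?thesis
      using False by (simp add: matrix_vector_mult_scaleR field_simps power2_eq_square)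
  qed simp
  \<comment> \<open>The residual \<open>w\<close> is, up to a factor, the direction of the first variation at \<open>v\<close>.\<close>
  define w where "w = A *v v - c *\<^sub>R v"
  define b where "b = w \<bullet> (A *v w) - c * (norm w)\<^sup>2"
  have b: "0 \<le> b"
    using le[of w] by (simp add: b_def)
  have quad: "0 \<le> t\<^sup>2 * b - 2 * t * (norm w)\<^sup>2" for t
  proof -
    have "(v - t *\<^sub>R w) \<bullet> (A *v (v - t *\<^sub>R w)) - c * (norm (v - t *\<^sub>R w))\<^sup>2
        = t\<^sup>2 * b - 2 * t * (norm w)\<^sup>2"
    proof -
      have "v \<bullet> (A *v w) = w \<bullet> (A *v v)"
        by (rule symmetric_matrix_inner[OF sym])
      moreover have "(norm w)\<^sup>2 = w \<bullet> (A *v v) - c * (w \<bullet> v)"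
        by (simp add: power2_norm_eq_inner) (simp add: w_def inner_diff_right)
      moreover have "(norm (v - t *\<^sub>R w))\<^sup>2 = 1 - 2 * t * (w \<bullet> v) + t\<^sup>2 * (norm w)\<^sup>2"
        using v unfolding power2_norm_eq_inner norm_eq_1
        by (simp add: inner_diff_left inner_diff_right inner_commute power2_eq_square)
      ultimately show ?thesis
        by (simp add: b_def matrix_vector_mult_diff_distrib matrix_vector_mult_scaleR
            inner_diff_left inner_diff_right flip: c_def)
          (simp add: algebra_simps power2_eq_square)
    qed
    then show ?thesis
      using le[of "v - t *\<^sub>R w"] by simp
  qed
  have "w = 0"
  proof (rule ccontr)
    assume "w \<noteq> 0"
    then have w: "0 < (norm w)\<^sup>2" by simp
    \<comment> \<open>For small positive \<open>t\<close> the linear term of \<open>quad\<close> dominates; this \<open>t\<close> is small enough.\<close>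
    define t where "t = (norm w)\<^sup>2 / (b + 1)"
    have t: "0 < t" using w b by (simp add: t_def)
    have "2 * (norm w)\<^sup>2 \<le> t * b"
      using quad[of t] t by (simp add: power2_eq_square)
    also have "\<dots> \<le> (norm w)\<^sup>2"
      using b by (simp add: t_def field_simps)
    finally show False using w by simp
  qed
  then have eigen: "A *v v = c *\<^sub>R v"
    by (simp add: w_def)
  have "min_eigenvalue A = c"
    unfolding min_eigenvalue_def
  proof (rule Least_equality)
    show "\<exists>v. v \<noteq> 0 \<and> A *v v = c *\<^sub>R v"
      using v eigen by (intro exI[of _ v]) auto
  next
    fix d assume "\<exists>v. v \<noteq> 0 \<and> A *v v = d *\<^sub>R v"
    then obtain u where "u \<noteq> 0" "A *v u = d *\<^sub>R u" by auto
    then have "c * (norm u)\<^sup>2 \<le> d * (norm u)\<^sup>2"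
      using le[of u] by (simp add: power2_norm_eq_inner)
    then show "c \<le> d" using \<open>u \<noteq> 0\<close> by simp
  qed
  then show ?thesis
    using v le by (intro that[of v]) (auto simp: c_def)
qed

lemma min_eigenvalue_mono:
  fixes A B :: "real^'n^'n"
  assumes "transpose A = A" "transpose B = B"
    and "\<And>u. u \<bullet> (A *v u) \<le> u \<bullet> (B *v u) + e * (norm u)\<^sup>2"
  shows "min_eigenvalue A \<le> min_eigenvalue B + e"
proof -
  obtain v where "norm v = 1" "min_eigenvalue B = v \<bullet> (B *v v)"
    using min_eigenvalue_rayleigh[OF assms(2)] by metis
  moreover have "min_eigenvalue A * (norm v)\<^sup>2 \<le> v \<bullet> (A *v v)"
    using min_eigenvalue_rayleigh[OF assms(1)] by metis
  ultimately show ?thesis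
    using assms(3)[of v] by simp
qed

section \<open>Objectives with Lipschitz gradient and Hessian\<close>

locale smooth_objective =
  fixes f :: "real^'n \<Rightarrow> real" and L\<^sub>g L\<^sub>H fbar :: real
  assumes C2: "twice_continuously_differentiable f"
    and L\<^sub>g_pos: "0 < L\<^sub>g" and L\<^sub>H_pos: "0 < L\<^sub>H"
    and grad_lipschitz: "L\<^sub>g-lipschitz_on UNIV (grad f)"
    and hess_lipschitz: "\<And>y z. onorm ((*v) (hess f y - hess f z)) \<le> L\<^sub>H * dist y z"
    and bounded_below: "\<And>y. fbar \<le> f y"
begin

lemma has_derivative_grad: "(f has_derivative (\<lambda>h. grad f y \<bullet> h)) (at y)"
proof -
  have "f differentiable at y"
    using C2 by (simp add: twice_continuously_differentiable_def differentiable_on_def)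
  then obtain f' where f': "(f has_derivative f') (at y)"
    by (auto simp: differentiable_def)
  have "f' h = h \<bullet> adjoint f' 1" for h
    using adjoint_works[OF has_derivative_linear[OF f'], of h 1] by simp
  then have "f' = (\<lambda>h. h \<bullet> adjoint f' 1)" by blast
  then have D: "GDERIV f y :> adjoint f' 1"
    using f' by (simp add: gderiv_def)
  moreover have "E = adjoint f' 1" if "GDERIV f y :> E" for E
  proof -
    have "(\<lambda>h. h \<bullet> E) = (\<lambda>h. h \<bullet> adjoint f' 1)"
      using that D unfolding gderiv_def by (rule has_derivative_unique)
    then show ?thesis
      by (metis vector_eq_ldot)
  qed
  ultimately have "GDERIV f y :> grad f y"
    unfolding grad_def by (metis theI)
  then show ?thesis
    by (simp add: gderiv_def inner_commute)
qed

lemma has_derivative_hess: "(grad f has_derivative (*v) (hess f y)) (at y)"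
proof -
  have "grad f differentiable at y"
    using C2 by (simp add: twice_continuously_differentiable_def differentiable_on_def)
  then show ?thesis
    using jacobian_works[of "grad f" "at y"] by (simp add: hess_def)
qed

lemma deriv_along_line:
  "((\<lambda>t. f (y + t *\<^sub>R h)) has_real_derivative grad f (y + t *\<^sub>R h) \<bullet> h) (at t)"
proof -
  have "((\<lambda>t. y + t *\<^sub>R h) has_derivative (\<lambda>s. s *\<^sub>R h)) (at t)"
    by (auto intro!: derivative_eq_intros)
  from has_derivative_compose[OF this has_derivative_grad]
  show ?thesis
    by (simp add: has_field_derivative_def mult_commute_abs)
qed

lemma deriv_grad_along_line:
  "((\<lambda>t. grad f (y + t *\<^sub>R h) \<bullet> u) has_real_derivative (hess f (y + t *\<^sub>R h) *v h) \<bullet> u) (at t)"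
proof -
  have "((\<lambda>t. y + t *\<^sub>R h) has_derivative (\<lambda>s. s *\<^sub>R h)) (at t)"
    by (auto intro!: derivative_eq_intros)
  from has_derivative_inner_left[OF has_derivative_compose[OF this has_derivative_hess], of u]
  show ?thesis
    by (simp add: has_field_derivative_def mult_commute_abs matrix_vector_mult_scaleR)
qed

lemma grad_diff: "norm (grad f y - grad f z) \<le> L\<^sub>g * norm (y - z)"
  using lipschitz_onD[OF grad_lipschitz, of y z] by (simp add: dist_norm)

lemma hess_diff: "norm (hess f y *v v - hess f z *v v) \<le> L\<^sub>H * norm (y - z) * norm v"
proof -
  have "norm ((hess f y - hess f z) *v v) \<le> onorm ((*v) (hess f y - hess f z)) * norm v"
    by (rule onorm) simp
  also have "\<dots> \<le> L\<^sub>H * norm (y - z) * norm v"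
    using hess_lipschitz[of y z] by (intro mult_right_mono) (auto simp: dist_norm)
  finally show ?thesis
    by (simp add: matrix_vector_mult_diff_rdistrib)
qed

lemma hess_diff_inner: "\<bar>(hess f y *v v) \<bullet> u - (hess f z *v v) \<bullet> u\<bar> \<le> L\<^sub>H * norm (y - z) * norm v * norm u"
  using Cauchy_Schwarz_ineq2[of "hess f y *v v - hess f z *v v" u]
    mult_right_mono[OF hess_diff[of y v z], of "norm u"]
  by (simp add: inner_diff_left)

text \<open>
  The Hessian applied to \<open>v\<close> is a limit of difference quotients of the \<open>L\<^sub>g\<close>-Lipschitz gradient;
  testing them against the limit itself gives the bound.
\<close>

lemma norm_hess: "norm (hess f y *v v) \<le> L\<^sub>g * norm v"
proof -
  define u where "u = hess f y *v v"
  let ?\<phi> = "\<lambda>t. grad f (y + t *\<^sub>R v) \<bullet> u"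
  have "((\<lambda>h. norm ((?\<phi> (0 + h) - ?\<phi> 0) / h)) \<longlongrightarrow> norm (u \<bullet> u)) (at 0)"
    using deriv_grad_along_line[of y v u 0] unfolding DERIV_def
    by (intro tendsto_norm) (simp add: u_def)
  moreover have "\<forall>\<^sub>F h in at 0. norm ((?\<phi> (0 + h) - ?\<phi> 0) / h) \<le> L\<^sub>g * norm v * norm u"
  proof (rule eventually_at_filter[THEN iffD2], rule always_eventually, intro allI impI)
    fix h :: real assume h: "h \<noteq> 0"
    have "\<bar>?\<phi> (0 + h) - ?\<phi> 0\<bar> \<le> norm (grad f (y + h *\<^sub>R v) - grad f y) * norm u"
      using Cauchy_Schwarz_ineq2[of "grad f (y + h *\<^sub>R v) - grad f y" u]
      by (simp add: inner_diff_left)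
    also have "\<dots> \<le> L\<^sub>g * (\<bar>h\<bar> * norm v) * norm u"
      using grad_diff[of "y + h *\<^sub>R v" y] by (intro mult_right_mono) auto
    finally show "norm ((?\<phi> (0 + h) - ?\<phi> 0) / h) \<le> L\<^sub>g * norm v * norm u"
      using h by (simp add: field_simps)
  qed
  ultimately have "norm (u \<bullet> u) \<le> L\<^sub>g * norm v * norm u"
    by (rule tendsto_upperbound) simp
  then have "norm u * norm u \<le> (L\<^sub>g * norm v) * norm u"
    by (simp add: power2_norm_eq_inner[symmetric] power2_eq_square)
  then have "norm u \<le> L\<^sub>g * norm v"
    using L\<^sub>g_pos by (cases "norm u = 0") auto
  then show ?thesis by (simp add: u_def)
qed

text \<open>
  Two applications of the mean value theorem, first along \<open>u\<close> and then along \<open>v\<close>. The left-hand side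
  of the equation is symmetric in \<open>u\<close> and \<open>v\<close>, so the Hessian form is symmetric in the limit.
\<close>

lemma mixed_second_difference:
  assumes t: "0 < t"
  obtains z where "norm (z - y) \<le> t * (norm u + norm v)"
    "f (y + t *\<^sub>R u + t *\<^sub>R v) - f (y + t *\<^sub>R u) - f (y + t *\<^sub>R v) + f y
      = t\<^sup>2 * ((hess f z *v v) \<bullet> u)"
proof -
  let ?\<phi> = "\<lambda>s. f ((y + t *\<^sub>R v) + s *\<^sub>R u) - f (y + s *\<^sub>R u)"
  obtain s where s: "0 < s" "s < t" and
    1: "?\<phi> t - ?\<phi> 0 = (t - 0) * (grad f ((y + t *\<^sub>R v) + s *\<^sub>R u) \<bullet> u - grad f (y + s *\<^sub>R u) \<bullet> u)"
    using MVT2[OF t, of ?\<phi> "\<lambda>s. grad f ((y + t *\<^sub>R v) + s *\<^sub>R u) \<bullet> u - grad f (y + s *\<^sub>R u) \<bullet> u"]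
      DERIV_diff[OF deriv_along_line deriv_along_line] by blast
  let ?\<psi> = "\<lambda>r. grad f ((y + s *\<^sub>R u) + r *\<^sub>R v) \<bullet> u"
  obtain r where r: "0 < r" "r < t" and
    2: "?\<psi> t - ?\<psi> 0 = (t - 0) * ((hess f ((y + s *\<^sub>R u) + r *\<^sub>R v) *v v) \<bullet> u)"
    using MVT2[OF t, of ?\<psi> "\<lambda>r. (hess f ((y + s *\<^sub>R u) + r *\<^sub>R v) *v v) \<bullet> u"]
      deriv_grad_along_line by blast
  show ?thesis
  proof (rule that[of "(y + s *\<^sub>R u) + r *\<^sub>R v"])
    have "norm (s *\<^sub>R u + r *\<^sub>R v) \<le> s * norm u + r * norm v"
      using norm_triangle_ineq[of "s *\<^sub>R u" "r *\<^sub>R v"] s r by simp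
    also have "\<dots> \<le> t * norm u + t * norm v"
      using s r by (intro add_mono mult_right_mono) auto
    finally show "norm ((y + s *\<^sub>R u) + r *\<^sub>R v - y) \<le> t * (norm u + norm v)"
      by (simp add: distrib_left)
    show "f (y + t *\<^sub>R u + t *\<^sub>R v) - f (y + t *\<^sub>R u) - f (y + t *\<^sub>R v) + f y
      = t\<^sup>2 * ((hess f ((y + s *\<^sub>R u) + r *\<^sub>R v) *v v) \<bullet> u)"
      using 1 2 by (simp add: power2_eq_square algebra_simps)
  qed
qed

text \<open>
  The symmetry of second derivatives. The Lipschitz bound on the Hessian gives the rate at which
  the two values supplied by \<open>mixed_second_difference\<close> approach those at \<open>y\<close>.
\<close>

lemma hess_inner_commute: "(hess f y *v v) \<bullet> u = (hess f y *v u) \<bullet> v"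
proof -
  define d where "d = \<bar>(hess f y *v v) \<bullet> u - (hess f y *v u) \<bullet> v\<bar>"
  define K where "K = 2 * L\<^sub>H * (norm u + norm v) * norm u * norm v"
  have bound: "d \<le> t * K" if t: "0 < t" for t
  proof -
    obtain z where z: "norm (z - y) \<le> t * (norm u + norm v)" and z_eq:
      "f (y + t *\<^sub>R u + t *\<^sub>R v) - f (y + t *\<^sub>R u) - f (y + t *\<^sub>R v) + f y
        = t\<^sup>2 * ((hess f z *v v) \<bullet> u)"
      using mixed_second_difference[OF t] .
    obtain z' where z': "norm (z' - y) \<le> t * (norm v + norm u)" and z'_eq:
      "f (y + t *\<^sub>R v + t *\<^sub>R u) - f (y + t *\<^sub>R v) - f (y + t *\<^sub>R u) + f y
        = t\<^sup>2 * ((hess f z' *v u) \<bullet> v)"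
      using mixed_second_difference[OF t] .
    have "t\<^sup>2 * ((hess f z *v v) \<bullet> u) = t\<^sup>2 * ((hess f z' *v u) \<bullet> v)"
      using z_eq z'_eq by (simp add: algebra_simps)
    then have "(hess f z *v v) \<bullet> u = (hess f z' *v u) \<bullet> v"
      using t by simp
    then have "d \<le> \<bar>(hess f z *v v) \<bullet> u - (hess f y *v v) \<bullet> u\<bar>
        + \<bar>(hess f z' *v u) \<bullet> v - (hess f y *v u) \<bullet> v\<bar>"
      by (simp add: d_def)
    also have "\<dots> \<le> L\<^sub>H * (t * (norm u + norm v)) * norm v * norm u
        + L\<^sub>H * (t * (norm v + norm u)) * norm u * norm v"
      using L\<^sub>H_pos z z'
      by (intro add_mono order.trans[OF hess_diff_inner] mult_right_mono mult_left_mono) auto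
    finally show ?thesis by (simp add: K_def algebra_simps)
  qed
  have "((\<lambda>t. t * K) \<longlongrightarrow> 0 * K) (at_right 0)"
    by (intro tendsto_intros)
  then have "d \<le> 0 * K"
    by (rule tendsto_lowerbound)
      (use bound in \<open>auto simp: eventually_at_filter\<close>)
  then show ?thesis by (simp add: d_def)
qed

lemma hess_symmetric: "transpose (hess f y) = hess f y"
proof -
  have "transpose (hess f y) *v v = hess f y *v v" for v
  proof (rule vector_eq_ldot[THEN iffD1], rule allI)
    fix u
    have "u \<bullet> (transpose (hess f y) *v v) = (hess f y *v u) \<bullet> v"
      by (metis dot_lmul_matrix inner_commute transpose_matrix_vector)
    also have "\<dots> = u \<bullet> (hess f y *v v)"
      by (metis hess_inner_commute inner_commute)
    finally show "u \<bullet> (transpose (hess f y) *v v) = u \<bullet> (hess f y *v v)" .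
  qed
  then show ?thesis
    by (simp add: matrix_eq)
qed

text \<open>
  The left-most eigenvalue is a minimum of Rayleigh quotients, hence as regular as the Hessian. In
  particular it is a Borel function of the point.
\<close>

lemma min_eigenvalue_hess_lipschitz:
  "\<bar>min_eigenvalue (hess f y) - min_eigenvalue (hess f z)\<bar> \<le> L\<^sub>H * norm (y - z)"
proof -
  have "min_eigenvalue (hess f y) \<le> min_eigenvalue (hess f z) + L\<^sub>H * norm (y - z)" for y z
    using hess_diff_inner[of y _ _ z]
    by (intro min_eigenvalue_mono hess_symmetric)
      (smt (verit) inner_commute mult.assoc power2_eq_square)
  from this[of y z] this[of z y] show ?thesis
    by (simp add: norm_minus_commute)
qed

lemma continuous_min_eigenvalue_hess: "continuous_on UNIV (\<lambda>y. min_eigenvalue (hess f y))"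
proof -
  have "L\<^sub>H-lipschitz_on UNIV (\<lambda>y. min_eigenvalue (hess f y))"
    using min_eigenvalue_hess_lipschitz L\<^sub>H_pos
    by (intro lipschitz_onI) (auto simp: dist_norm)
  then show ?thesis by (rule lipschitz_on_continuous_on)
qed

lemma abs_min_eigenvalue_hess_le: "\<bar>min_eigenvalue (hess f y)\<bar> \<le> L\<^sub>g"
proof -
  obtain v where "norm v = 1" "min_eigenvalue (hess f y) = v \<bullet> (hess f y *v v)"
    using min_eigenvalue_rayleigh[OF hess_symmetric] by metis
  then show ?thesis
    using Cauchy_Schwarz_ineq2[of v "hess f y *v v"] norm_hess[of y v] by simp
qed

lemma quadratic_upper_bound: "f (y + h) \<le> f y + grad f y \<bullet> h + L\<^sub>g / 2 * (norm h)\<^sup>2"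
proof -
  let ?\<phi> = "\<lambda>t. f y + t * (grad f y \<bullet> h) + L\<^sub>g / 2 * t\<^sup>2 * (norm h)\<^sup>2 - f (y + t *\<^sub>R h)"
  have "?\<phi> 0 \<le> ?\<phi> 1"
  proof (rule DERIV_nonneg_imp_nondecreasing[where f = ?\<phi>])
    fix t :: real assume t: "0 \<le> t" "t \<le> 1"
    have "(?\<phi> has_real_derivative
        grad f y \<bullet> h + L\<^sub>g * t * (norm h)\<^sup>2 - grad f (y + t *\<^sub>R h) \<bullet> h) (at t)"
      by (auto intro!: derivative_eq_intros deriv_along_line)
    moreover have "(grad f (y + t *\<^sub>R h) - grad f y) \<bullet> h \<le> L\<^sub>g * (t * norm h) * norm h"
      using norm_cauchy_schwarz[of "grad f (y + t *\<^sub>R h) - grad f y" h] t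
        mult_right_mono[OF grad_diff[of "y + t *\<^sub>R h" y], of "norm h"] by simp
    then have "0 \<le> grad f y \<bullet> h + L\<^sub>g * t * (norm h)\<^sup>2 - grad f (y + t *\<^sub>R h) \<bullet> h"
      by (simp add: inner_diff_left power2_eq_square)
    ultimately show "\<exists>d. (?\<phi> has_real_derivative d) (at t) \<and> 0 \<le> d" by blast
  qed simp
  then show ?thesis by simp
qed

text \<open>
  The difference \<open>\<phi>\<close> of the two sides along the segment vanishes to first order at \<open>0\<close>, and its second
  derivative is nonnegative by the Lipschitz bound on the Hessian. Hence \<open>\<phi>'\<close>, called \<open>\<psi>\<close>, is
  nonnegative on the segment, and so is \<open>\<phi>\<close>.
\<close>

lemma cubic_upper_bound:
  "f (y + h) \<le> f y + grad f y \<bullet> h + (h \<bullet> (hess f y *v h)) / 2 + L\<^sub>H / 6 * norm h ^ 3"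
proof -
  let ?\<psi> = "\<lambda>t. grad f y \<bullet> h + t * (h \<bullet> (hess f y *v h)) + L\<^sub>H / 2 * t\<^sup>2 * norm h ^ 3
      - grad f (y + t *\<^sub>R h) \<bullet> h"
  have mono': "?\<psi> 0 \<le> ?\<psi> s" if "0 \<le> s" for s
  proof (rule DERIV_nonneg_imp_nondecreasing[where f = ?\<psi>, OF that])
    fix t :: real assume t: "0 \<le> t" "t \<le> s"
    have "(?\<psi> has_real_derivative
        h \<bullet> (hess f y *v h) + L\<^sub>H * t * norm h ^ 3 - (hess f (y + t *\<^sub>R h) *v h) \<bullet> h) (at t)"
      by (auto intro!: derivative_eq_intros deriv_grad_along_line)
    moreover have "(hess f (y + t *\<^sub>R h) *v h) \<bullet> h - (hess f y *v h) \<bullet> h \<le> L\<^sub>H * (t * norm h) * norm h * norm h"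
      using hess_diff_inner[of "y + t *\<^sub>R h" h h y] t by simp
    then have "0 \<le> h \<bullet> (hess f y *v h) + L\<^sub>H * t * norm h ^ 3 - (hess f (y + t *\<^sub>R h) *v h) \<bullet> h"
      by (simp add: power3_eq_cube inner_commute mult.assoc)
    ultimately show "\<exists>d. (?\<psi> has_real_derivative d) (at t) \<and> 0 \<le> d" by blast
  qed
  let ?\<phi> = "\<lambda>t. f y + t * (grad f y \<bullet> h) + t\<^sup>2 / 2 * (h \<bullet> (hess f y *v h))
      + L\<^sub>H / 6 * t ^ 3 * norm h ^ 3 - f (y + t *\<^sub>R h)"
  have "?\<phi> 0 \<le> ?\<phi> 1"
  proof (rule DERIV_nonneg_imp_nondecreasing[where f = ?\<phi>])
    fix t :: real assume t: "0 \<le> t" "t \<le> 1"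
    have "(?\<phi> has_real_derivative ?\<psi> t) (at t)"
      by (auto intro!: derivative_eq_intros deriv_along_line)
    then show "\<exists>d. (?\<phi> has_real_derivative d) (at t) \<and> 0 \<le> d"
      using mono'[of t] t by auto
  qed simp
  then show ?thesis by simp
qed

text \<open>
  A gradient step of length \<open>1 / L\<^sub>g\<close> cannot fall below \<open>fbar\<close>. This makes the gradient square
  integrable as soon as the optimality gap is integrable.
\<close>

lemma norm_grad_sq_le: "(norm (grad f y))\<^sup>2 \<le> 2 * L\<^sub>g * (f y - fbar)"
proof -
  have "fbar \<le> f (y + (- 1 / L\<^sub>g) *\<^sub>R grad f y)"
    by (rule bounded_below)
  also have "\<dots> \<le> f y - (norm (grad f y))\<^sup>2 / (2 * L\<^sub>g)"
    using quadratic_upper_bound[of y "(- 1 / L\<^sub>g) *\<^sub>R grad f y"] L\<^sub>g_pos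
    by (simp add: power2_norm_eq_inner[symmetric] power_mult_distrib power_divide)
      (simp add: field_simps power2_eq_square)
  finally show ?thesis
    using L\<^sub>g_pos by (simp add: field_simps)
qed

lemma continuous_f: "continuous_on UNIV f"
  by (meson has_derivative_continuous_on has_derivative_grad has_derivative_at_withinI)

lemma continuous_grad: "continuous_on UNIV (grad f)"
  using grad_lipschitz by (rule lipschitz_on_continuous_on)

lemma continuous_hess: "continuous_on UNIV (hess f)"
  using C2 by (simp add: twice_continuously_differentiable_def)

definition neg_curv :: "real^'n \<Rightarrow> real" where
  "neg_curv y = - min (min_eigenvalue (hess f y)) 0"

lemma neg_curv_nonneg: "0 \<le> neg_curv y"
  by (simp add: neg_curv_def)

lemma abs_min_eigenvalue_hess: "\<bar>min (min_eigenvalue (hess f y)) 0\<bar> = neg_curv y"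
  by (simp add: neg_curv_def)

lemma neg_curv_le: "neg_curv y \<le> L\<^sub>g"
  using abs_min_eigenvalue_hess_le[of y] L\<^sub>g_pos by (auto simp: neg_curv_def min_def)

lemma continuous_neg_curv: "continuous_on UNIV neg_curv"
  unfolding neg_curv_def[abs_def] by (intro continuous_intros continuous_min_eigenvalue_hess)

end

section \<open>Conditional bounds and localization\<close>

context sigma_finite_subalgebra
begin

text \<open>
  The common shape of conditions (A), (B) and the variance bound in (C), turned into an
  inequality between ordinary integrals with an \<open>F\<close>-measurable weight \<open>w\<close>.
\<close>

lemma nn_integral_le_of_nn_cond_exp_le:
  assumes [measurable]: "X \<in> borel_measurable M" "Y \<in> borel_measurable M"
    "w \<in> borel_measurable F" "c \<in> borel_measurable F" "d \<in> borel_measurable F"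
    and le: "AE \<omega> in M. nn_cond_exp M F X \<omega> \<le> c \<omega> * nn_cond_exp M F Y \<omega> + d \<omega>"
  shows "(\<integral>\<^sup>+\<omega>. w \<omega> * X \<omega> \<partial>M) \<le> (\<integral>\<^sup>+\<omega>. w \<omega> * c \<omega> * Y \<omega> \<partial>M) + (\<integral>\<^sup>+\<omega>. w \<omega> * d \<omega> \<partial>M)"
proof -
  have [measurable]: "w \<in> borel_measurable M" "c \<in> borel_measurable M" "d \<in> borel_measurable M"
    using assms(3-5) by (auto intro: measurable_from_subalg[OF subalg])
  have "(\<integral>\<^sup>+\<omega>. w \<omega> * X \<omega> \<partial>M) = (\<integral>\<^sup>+\<omega>. w \<omega> * nn_cond_exp M F X \<omega> \<partial>M)"
    by (rule nn_cond_exp_intg[symmetric]) measurable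
  also have "\<dots> \<le> (\<integral>\<^sup>+\<omega>. (w \<omega> * c \<omega>) * nn_cond_exp M F Y \<omega> + w \<omega> * d \<omega> \<partial>M)"
  proof (rule nn_integral_mono_AE, use le in eventually_elim)
    case (elim \<omega>)
    have "w \<omega> * nn_cond_exp M F X \<omega> \<le> w \<omega> * (c \<omega> * nn_cond_exp M F Y \<omega> + d \<omega>)"
      by (rule mult_left_mono[OF elim]) simp
    then show ?case by (simp add: distrib_left mult.assoc)
  qed
  also have "\<dots> = (\<integral>\<^sup>+\<omega>. (w \<omega> * c \<omega>) * nn_cond_exp M F Y \<omega> \<partial>M) + (\<integral>\<^sup>+\<omega>. w \<omega> * d \<omega> \<partial>M)"
    by (rule nn_integral_add) measurable
  also have "(\<integral>\<^sup>+\<omega>. (w \<omega> * c \<omega>) * nn_cond_exp M F Y \<omega> \<partial>M) = (\<integral>\<^sup>+\<omega>. (w \<omega> * c \<omega>) * Y \<omega> \<partial>M)"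
    by (rule nn_cond_exp_intg) measurable
  finally show ?thesis .
qed

end

text \<open>
  If \<open>Y\<close> has almost surely finite conditional expectation, then the space is exhausted by the
  \<open>F\<close>-measurable sets on which this conditional expectation is at most \<open>j\<close>, and \<open>Y\<close> is
  integrable on each of these. So a bound may be proved on \<open>F\<close>-measurable sets on which \<open>Y\<close> is
  integrable, although \<open>Y\<close> need not be integrable on the whole space.
\<close>

lemma (in finite_measure_subalgebra) nn_integral_le_by_localization:
  assumes [measurable]: "Y \<in> borel_measurable M" "Z \<in> borel_measurable M"
    and fin: "AE \<omega> in M. nn_cond_exp M F Y \<omega> < \<infinity>"
    and le: "\<And>A. A \<in> sets F \<Longrightarrow> (\<integral>\<^sup>+\<omega>. indicator A \<omega> * Y \<omega> \<partial>M) < \<infinity>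
      \<Longrightarrow> (\<integral>\<^sup>+\<omega>. indicator A \<omega> * Z \<omega> \<partial>M) \<le> K"
  shows "(\<integral>\<^sup>+\<omega>. Z \<omega> \<partial>M) \<le> K"
proof -
  define A where "A j = {\<omega> \<in> space F. nn_cond_exp M F Y \<omega> \<le> of_nat j}" for j :: nat
  have AF [measurable]: "A j \<in> sets F" for j
    unfolding A_def by measurable
  have AM [measurable]: "A j \<in> sets M" for j
    using AF subalg by (auto simp: subalgebra_def)
  have finite_on: "(\<integral>\<^sup>+\<omega>. indicator (A j) \<omega> * Y \<omega> \<partial>M) < \<infinity>" for j
  proof -
    have "(\<integral>\<^sup>+\<omega>. indicator (A j) \<omega> * Y \<omega> \<partial>M)
        = (\<integral>\<^sup>+\<omega>. indicator (A j) \<omega> * nn_cond_exp M F Y \<omega> \<partial>M)"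
      by (rule nn_cond_exp_intg[symmetric]) measurable
    also have "\<dots> \<le> (\<integral>\<^sup>+\<omega>. of_nat j \<partial>M)"
      by (intro nn_integral_mono) (auto simp: A_def indicator_def)
    also have "\<dots> < \<infinity>"
      using emeasure_finite[of "space M"]
      by (simp add: ennreal_mult_eq_top_iff less_top[symmetric])
    finally show ?thesis .
  qed
  have "AE \<omega> in M. Z \<omega> = (SUP j. indicator (A j) \<omega> * Z \<omega>)"
    using fin AE_space
  proof eventually_elim
    case (elim \<omega>)
    then have "nn_cond_exp M F Y \<omega> < top" by simp
    then obtain j where "nn_cond_exp M F Y \<omega> < of_nat j"
      using ennreal_Ex_less_of_nat by blast
    then have j: "nn_cond_exp M F Y \<omega> \<le> of_nat j"
      by (rule less_imp_le)
    have "\<omega> \<in> A j"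
      using elim j subalg by (simp add: A_def subalgebra_def)
    show ?case
    proof (rule antisym)
      show "Z \<omega> \<le> (SUP j. indicator (A j) \<omega> * Z \<omega>)"
        using \<open>\<omega> \<in> A j\<close> by (intro SUP_upper2[of j]) auto
      show "(SUP j. indicator (A j) \<omega> * Z \<omega>) \<le> Z \<omega>"
        by (rule SUP_least) (auto simp: indicator_def)
    qed
  qed
  then have "(\<integral>\<^sup>+\<omega>. Z \<omega> \<partial>M) = (\<integral>\<^sup>+\<omega>. (SUP j. indicator (A j) \<omega> * Z \<omega>) \<partial>M)"
    by (rule nn_integral_cong_AE)
  also have "\<dots> = (SUP j. \<integral>\<^sup>+\<omega>. indicator (A j) \<omega> * Z \<omega> \<partial>M)"
  proof (rule nn_integral_monotone_convergence_SUP)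
    show "incseq (\<lambda>j \<omega>. indicator (A j) \<omega> * Z \<omega>)"
    proof (rule incseq_SucI, rule le_funI)
      fix j \<omega>
      have "(of_nat j :: ennreal) \<le> of_nat (Suc j)"
        by (rule of_nat_mono) simp
      then have "A j \<subseteq> A (Suc j)"
        unfolding A_def by (auto simp del: of_nat_Suc intro: order.trans)
      then show "indicator (A j) \<omega> * Z \<omega> \<le> indicator (A (Suc j)) \<omega> * Z \<omega>"
        by (intro mult_right_mono indicator_leI) auto
    qed
  qed measurable
  also have "\<dots> \<le> K"
    by (rule SUP_least) (rule le[OF AF finite_on])
  finally show ?thesis .
qed

lemma subalgebra_generated_by:
  assumes "\<And>Y. Y \<in> X \<Longrightarrow> Y \<in> borel_measurable M"
  shows "subalgebra M (generated_by M X)"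
proof -
  have "{Y -` B \<inter> space M |Y B. Y \<in> X \<and> B \<in> sets borel} \<subseteq> sets M"
    using assms by (auto intro: measurable_sets)
  then show ?thesis
    unfolding subalgebra_def generated_by_def
    by (simp add: space_measure_of_conv sets_measure_of_conv sets.sigma_sets_subset)
qed

lemma space_generated_by: "space (generated_by M X) = space M"
  by (simp add: generated_by_def space_measure_of_conv)

lemma sets_generated_by:
  "sets (generated_by M X)
    = sigma_sets (space M) {Y -` B \<inter> space M |Y B. Y \<in> X \<and> B \<in> sets borel}"
  unfolding generated_by_def by (rule sets_measure_of) auto

lemma measurable_generated_by:
  fixes Y :: "'a \<Rightarrow> real^'n"
  assumes "Y \<in> X"
  shows "Y \<in> borel_measurable (generated_by M X)"
proof (rule measurableI)
  fix B :: "(real^'n) set" assume "B \<in> sets borel"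
  then show "Y -` B \<inter> space (generated_by M X) \<in> sets (generated_by M X)"
    unfolding space_generated_by sets_generated_by
    by (intro sigma_sets.Basic CollectI exI[of _ Y] exI[of _ B] conjI refl assms)
next
  fix \<omega> show "Y \<omega> \<in> space borel" by simp
qed

lemma generated_by_mono:
  fixes X X' :: "('a \<Rightarrow> real^'n) set"
  assumes "X \<subseteq> X'"
  shows "sets (generated_by M X) \<subseteq> sets (generated_by M X')"
  unfolding sets_generated_by
proof (rule sigma_sets_mono')
  show "{Y -` B \<inter> space M |Y B. Y \<in> X \<and> B \<in> sets borel}
      \<subseteq> {Y -` B \<inter> space M |Y B. Y \<in> X' \<and> B \<in> sets borel}"
    using subsetD[OF assms] by (intro Collect_mono) metis
qed

lemma borel_measurable_vec_component [measurable (raw)]: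
  fixes X :: "'a \<Rightarrow> real^'n"
  assumes "X \<in> borel_measurable N"
  shows "(\<lambda>\<omega>. X \<omega> $ j) \<in> borel_measurable N"
  using assms by (rule borel_measurable_continuous_on[rotated]) (intro continuous_intros)

section \<open>Convergence of means\<close>

lemma summable_of_descent:
  fixes s u v :: "nat \<Rightarrow> real"
  assumes nonneg: "\<And>k. 0 \<le> s k" "\<And>k. 0 \<le> u k" "\<And>k. 0 \<le> v k"
    and descent: "\<And>k. s (Suc k) + u k \<le> s k + v k"
    and v: "summable v"
  shows "summable u"
proof (rule summableI_nonneg_bounded[where x = "s 0 + suminf v"])
  fix n
  have "s n + (\<Sum>k<n. u k) \<le> s 0 + (\<Sum>k<n. v k)"
  proof (induction n)
    case (Suc n)
    then show ?case using descent[of n] by simp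
  qed simp
  also have "(\<Sum>k<n. v k) \<le> suminf v"
    by (intro sum_le_suminf v) (use nonneg in auto)
  finally show "(\<Sum>k<n. u k) \<le> s 0 + suminf v"
    using nonneg(1)[of n] by simp
qed (use nonneg in auto)

text \<open>
  Either \<open>r \<le> e\<close>, or \<open>r\<close> exceeds \<open>e\<close> and then \<open>(r / e)\<^sup>n\<^sup>-\<^sup>1 \<ge> 1\<close>. It replaces the inequality of Jensen in
  deducing the convergence of first moments from that of higher moments.
\<close>

lemma le_add_power_div:
  fixes r e :: real
  assumes "0 \<le> r" "0 < e" "0 < n"
  shows "r \<le> e + r ^ n / e ^ (n - 1)"
proof (cases "r \<le> e")
  case False
  then have "r * e ^ (n - 1) \<le> r * r ^ (n - 1)"
    using assms by (intro mult_left_mono power_mono) auto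
  also have "r * r ^ (n - 1) = r ^ n"
    using assms by (simp add: power_eq_if)
  finally have "r \<le> r ^ n / e ^ (n - 1)"
    using assms by (simp add: pos_le_divide_eq)
  then show ?thesis using assms by simp
next
  case True
  moreover have "0 \<le> r ^ n / e ^ (n - 1)" using assms by simp
  ultimately show ?thesis by linarith
qed

context prob_space
begin

lemma integrable_of_integrable_power:
  fixes r :: "'a \<Rightarrow> real"
  assumes [measurable]: "r \<in> borel_measurable M" and nonneg: "\<And>\<omega>. 0 \<le> r \<omega>" and n: "0 < n"
    and int: "integrable M (\<lambda>\<omega>. r \<omega> ^ n)"
  shows "integrable M r"
proof (rule Bochner_Integration.integrable_bound)
  show "integrable M (\<lambda>\<omega>. 1 + r \<omega> ^ n)"
    using int by simp
  show "AE \<omega> in M. norm (r \<omega>) \<le> norm (1 + r \<omega> ^ n)"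
  proof (rule AE_I2)
    fix \<omega>
    have "0 \<le> r \<omega> ^ n"
      by (intro zero_le_power nonneg)
    then show "norm (r \<omega>) \<le> norm (1 + r \<omega> ^ n)"
      using le_add_power_div[of "r \<omega>" 1 n] nonneg[of \<omega>] n by simp
  qed
qed measurable

lemma mean_tendsto_0_of_power_mean:
  fixes r :: "nat \<Rightarrow> 'a \<Rightarrow> real"
  assumes [measurable]: "\<And>k. r k \<in> borel_measurable M" and nonneg: "\<And>k \<omega>. 0 \<le> r k \<omega>" and n: "0 < n"
    and int: "\<And>k. integrable M (\<lambda>\<omega>. r k \<omega> ^ n)"
    and lim: "(\<lambda>k. \<integral>\<omega>. r k \<omega> ^ n \<partial>M) \<longlonglongrightarrow> 0"
  shows "(\<lambda>k. \<integral>\<omega>. r k \<omega> \<partial>M) \<longlonglongrightarrow> 0"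
proof (rule order_tendstoI)
  fix a :: real assume "a < 0"
  moreover have "0 \<le> (\<integral>\<omega>. r k \<omega> \<partial>M)" for k
    by (intro Bochner_Integration.integral_nonneg nonneg)
  ultimately show "\<forall>\<^sub>F k in sequentially. a < (\<integral>\<omega>. r k \<omega> \<partial>M)"
    by (intro always_eventually) (auto intro: less_le_trans)
next
  fix a :: real assume a: "0 < a"
  define e where "e = a / 2"
  have e: "0 < e" using a by (simp add: e_def)
  have "\<forall>\<^sub>F k in sequentially. (\<integral>\<omega>. r k \<omega> ^ n \<partial>M) < e * e ^ (n - 1)"
    using e by (intro order_tendstoD[OF lim]) auto
  then show "\<forall>\<^sub>F k in sequentially. (\<integral>\<omega>. r k \<omega> \<partial>M) < a"
  proof eventually_elim
    case (elim k)
    have "(\<integral>\<omega>. r k \<omega> \<partial>M) \<le> (\<integral>\<omega>. e + r k \<omega> ^ n / e ^ (n - 1) \<partial>M)"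
    proof (rule integral_mono)
      show "integrable M (r k)"
        by (rule integrable_of_integrable_power[OF _ nonneg n int]) measurable
      show "integrable M (\<lambda>\<omega>. e + r k \<omega> ^ n / e ^ (n - 1))"
        using int[of k] by simp
    qed (rule le_add_power_div[OF nonneg e n])
    also have "\<dots> = e + (\<integral>\<omega>. r k \<omega> ^ n \<partial>M) / e ^ (n - 1)"
      using int[of k] by (subst Bochner_Integration.integral_add) (auto simp: prob_space)
    also have "\<dots> < e + e"
      using elim e by (simp add: field_simps)
    finally show ?case by (simp add: e_def)
  qed
qed

end

section \<open>The method with constant step sizes\<close>

locale two_step_constant_steps =
  smooth_objective f L\<^sub>g L\<^sub>H fbar +
  stochastic_two_step_method M f x0 "\<lambda>_. \<alpha>" "\<lambda>_. \<beta>" \<gamma> \<gamma>\<^sub>H \<gamma>\<^sub>l \<delta> "\<lambda>_. \<theta>" \<sigma> "\<lambda>_. \<theta>h" \<sigma>h x xh p q g gh H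
  for f :: "real^'n \<Rightarrow> real" and L\<^sub>g L\<^sub>H fbar :: real and M :: "'a measure" and x0 :: "real^'n"
    and \<alpha> \<beta> \<gamma> \<gamma>\<^sub>H \<gamma>\<^sub>l \<delta> \<theta> \<theta>h :: real and \<sigma> \<sigma>h :: "nat \<Rightarrow> real"
    and x xh p q g gh :: "nat \<Rightarrow> 'a \<Rightarrow> real^'n" and H :: "nat \<Rightarrow> 'a \<Rightarrow> real^'n^'n" +
  assumes \<gamma>\<^sub>H_nonneg: "0 \<le> \<gamma>\<^sub>H" and \<gamma>\<^sub>l_nonneg: "0 \<le> \<gamma>\<^sub>l" and \<gamma>\<^sub>l_less: "\<gamma>\<^sub>l < 1"
    and \<gamma>\<^sub>H_less: "\<gamma>\<^sub>H < \<gamma> * (1 - \<gamma>\<^sub>l)"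
    and \<delta>_pos: "0 < \<delta>" and \<theta>_nonneg: "0 \<le> \<theta>" and \<theta>_less: "\<theta> < 1"
    and \<alpha>_pos: "0 < \<alpha>" and \<alpha>_le: "\<alpha> \<le> 1 / (L\<^sub>g * (1 + \<theta>h\<^sup>2))"
    and \<beta>_pos: "0 < \<beta>" and \<beta>_le: "\<beta> \<le> 3 * (\<gamma> - \<gamma>\<^sub>H / (1 - \<gamma>\<^sub>l)) / (2 * \<delta> * L\<^sub>H)"
begin

text \<open>
  The absolute value of the negative part of the left-most eigenvalue of \<open>H k\<close>, expressed through
  the length of \<open>q k\<close>, because this makes it evidently measurable.
\<close>

definition curv :: "nat \<Rightarrow> 'a \<Rightarrow> real" where
  "curv k \<omega> = norm (q k \<omega>) / \<delta>"

abbreviation gap :: "real^'n \<Rightarrow> real" where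
  "gap y \<equiv> f y - fbar"

abbreviation history :: "nat \<Rightarrow> 'a measure" where
  "history k \<equiv> generated_by M {x i |i. i \<le> k}"

abbreviation history_direction :: "nat \<Rightarrow> 'a measure" where
  "history_direction k \<equiv> generated_by M (insert (q k) {x i |i. i \<le> k})"

abbreviation history_trial :: "nat \<Rightarrow> 'a measure" where
  "history_trial k \<equiv> generated_by M (insert (xh k) {x i |i. i \<le> k})"

lemma gap_nonneg: "0 \<le> gap y"
  using bounded_below[of y] by simp

lemma curv_nonneg: "0 \<le> curv k \<omega>"
  using \<delta>_pos by (simp add: curv_def)

lemma min_eigenvalue_H: "min (min_eigenvalue (H k \<omega>)) 0 = - curv k \<omega>" if "\<omega> \<in> space M"
  using A_nonneg[OF that, of k] A_neg[OF that, of k] \<delta>_pos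
  by (cases "min_eigenvalue (H k \<omega>) < 0") (auto simp: curv_def)

text \<open>
  The formula also covers the case of nonnegative curvature, where \<open>q k\<close> is zero. As it does not
  mention the eigenvalue, it shows that \<open>p k\<close> is measurable.
\<close>

lemma p_eq: "p k \<omega> = (if g k \<omega> \<bullet> q k \<omega> \<le> 0 then q k \<omega> else - q k \<omega>)" if "\<omega> \<in> space M"
  using A_nonneg[OF that, of k] A_neg[OF that, of k]
  by (cases "min_eigenvalue (H k \<omega>) < 0") auto

lemma norm_p: "norm (p k \<omega>) = \<delta> * curv k \<omega>" if "\<omega> \<in> space M"
  using p_eq[OF that, of k] \<delta>_pos by (simp add: curv_def)

lemma curvature_along_p:
  assumes "\<omega> \<in> space M"
  shows "p k \<omega> \<bullet> (H k \<omega> *v p k \<omega>) \<le> - (\<gamma> * \<delta>\<^sup>2 * curv k \<omega> ^ 3)"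
proof (cases "min_eigenvalue (H k \<omega>) < 0")
  case True
  have "p k \<omega> \<bullet> (H k \<omega> *v p k \<omega>) = q k \<omega> \<bullet> (H k \<omega> *v q k \<omega>)"
    using p_eq[OF assms, of k] by (simp add: scaleR_minus_left[symmetric]
        matrix_vector_mult_scaleR[of _ "- 1", simplified])
  also have "\<dots> \<le> \<gamma> * min_eigenvalue (H k \<omega>) * (norm (q k \<omega>))\<^sup>2"
    using A_neg[OF assms True] by blast
  also have "min_eigenvalue (H k \<omega>) = - curv k \<omega>"
    using min_eigenvalue_H[OF assms, of k] True by simp
  also have "norm (q k \<omega>) = \<delta> * curv k \<omega>"
    using \<delta>_pos by (simp add: curv_def)
  finally show ?thesis
    by (simp add: power2_eq_square power3_eq_cube algebra_simps)
next
  case False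
  then show ?thesis
    using A_nonneg[OF assms, of k] by (auto simp: curv_def)
qed

lemma measurable_data [measurable]:
  "q k \<in> borel_measurable M" "g k \<in> borel_measurable M" "gh k \<in> borel_measurable M"
  "H k \<in> borel_measurable M"
  by (rule random)+

lemma measurable_curv [measurable]: "curv k \<in> borel_measurable M"
  unfolding curv_def[abs_def] by measurable

lemma measurable_p [measurable]: "p k \<in> borel_measurable M"
proof -
  have "(\<lambda>\<omega>. if g k \<omega> \<bullet> q k \<omega> \<le> 0 then q k \<omega> else - q k \<omega>) \<in> borel_measurable M"
    by measurable
  then show ?thesis
    using p_eq by (subst measurable_cong) auto
qed

lemma measurable_xh_if: "xh k \<in> borel_measurable M" if [measurable]: "x k \<in> borel_measurable M"
proof -
  have "(\<lambda>\<omega>. x k \<omega> + \<beta> *\<^sub>R p k \<omega>) \<in> borel_measurable M"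
    by measurable
  then show ?thesis
    using curvature_step by (subst measurable_cong) auto
qed

lemma measurable_x [measurable]: "x k \<in> borel_measurable M"
proof (induction k)
  case 0
  have "(\<lambda>\<omega>. x0) \<in> borel_measurable M" by simp
  then show ?case
    using initial by (subst measurable_cong) auto
next
  case (Suc k)
  have [measurable]: "xh k \<in> borel_measurable M"
    by (rule measurable_xh_if[OF Suc])
  have "(\<lambda>\<omega>. xh k \<omega> + \<alpha> *\<^sub>R (- gh k \<omega>)) \<in> borel_measurable M"
    by measurable
  then show ?case
    using gradient_step by (subst measurable_cong) auto
qed

lemma measurable_xh [measurable]: "xh k \<in> borel_measurable M"
  by (rule measurable_xh_if) measurable

lemma measurable_comp [measurable (raw)]:
  assumes "X \<in> borel_measurable N"
  shows "(\<lambda>\<omega>. f (X \<omega>)) \<in> borel_measurable N" "(\<lambda>\<omega>. grad f (X \<omega>)) \<in> borel_measurable N"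
    "(\<lambda>\<omega>. hess f (X \<omega>)) \<in> borel_measurable N" "(\<lambda>\<omega>. neg_curv (X \<omega>)) \<in> borel_measurable N"
    "(\<lambda>\<omega>. min_eigenvalue (hess f (X \<omega>))) \<in> borel_measurable N"
  using assms by (rule borel_measurable_continuous_on[OF continuous_f]
      borel_measurable_continuous_on[OF continuous_grad]
      borel_measurable_continuous_on[OF continuous_hess]
      borel_measurable_continuous_on[OF continuous_neg_curv]
      borel_measurable_continuous_on[OF continuous_min_eigenvalue_hess])+

lemma measurable_hess_error [measurable]:
  "(\<lambda>\<omega>. (H k \<omega> - hess f (x k \<omega>)) *v p k \<omega>) \<in> borel_measurable M"
proof (rule borel_measurable_continuous_Pair[where H = "\<lambda>A v. A *v v"])
  show "continuous_on UNIV (\<lambda>z::(real^'n^'n) \<times> (real^'n). fst z *v snd z)"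
    unfolding matrix_vector_mult_def by (intro continuous_intros)
qed measurable

lemma subalgebra_history: "finite_measure_subalgebra M (history k)"
  by unfold_locales (auto intro!: subalgebra_generated_by)

lemma subalgebra_history_direction: "finite_measure_subalgebra M (history_direction k)"
  by unfold_locales (auto intro!: subalgebra_generated_by)

lemma subalgebra_history_trial: "finite_measure_subalgebra M (history_trial k)"
  by unfold_locales (auto intro!: subalgebra_generated_by)

lemma measurable_history [measurable]: "x k \<in> borel_measurable (history k)"
  by (rule measurable_generated_by) auto

lemma measurable_history_trial [measurable]: "xh k \<in> borel_measurable (history_trial k)"
  by (rule measurable_generated_by) auto

lemma sets_history: "sets (history k) \<subseteq> sets M" "sets (history k) \<subseteq> sets (history_direction k)"
proof -
  interpret finite_measure_subalgebra M "history k" by (rule subalgebra_history)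
  show "sets (history k) \<subseteq> sets M"
    using subalg by (simp add: subalgebra_def)
  show "sets (history k) \<subseteq> sets (history_direction k)"
    by (rule generated_by_mono) auto
qed

lemma integrable_neg_curv: "integrable M (\<lambda>\<omega>. neg_curv (x k \<omega>))"
  by (rule integrable_const_bound[where B = L\<^sub>g])
    (auto simp: neg_curv_nonneg neg_curv_le)

lemma nn_eigenvalue_error:
  assumes [measurable]: "w \<in> borel_measurable (history k)"
  shows "(\<integral>\<^sup>+\<omega>. w \<omega> * ennreal \<bar>curv k \<omega> - neg_curv (x k \<omega>)\<bar> \<partial>M)
    \<le> (\<integral>\<^sup>+\<omega>. w \<omega> * ennreal (\<gamma>\<^sub>l * neg_curv (x k \<omega>)) \<partial>M)"
proof -
  interpret finite_measure_subalgebra M "history k" by (rule subalgebra_history)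
  let ?X = "\<lambda>\<omega>. ennreal \<bar>min (min_eigenvalue (H k \<omega>)) 0 - min (min_eigenvalue (hess f (x k \<omega>))) 0\<bar>"
  have X: "?X \<omega> = ennreal \<bar>curv k \<omega> - neg_curv (x k \<omega>)\<bar>" if "\<omega> \<in> space M" for \<omega>
    using min_eigenvalue_H[OF that, of k] by (simp add: neg_curv_def abs_minus_commute)
  have "?X \<in> borel_measurable M \<longleftrightarrow> (\<lambda>\<omega>. ennreal \<bar>curv k \<omega> - neg_curv (x k \<omega>)\<bar>) \<in> borel_measurable M"
    by (rule measurable_cong) (rule X)
  moreover have "(\<lambda>\<omega>. ennreal \<bar>curv k \<omega> - neg_curv (x k \<omega>)\<bar>) \<in> borel_measurable M"
    by measurable
  ultimately have [measurable]: "?X \<in> borel_measurable M"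
    by blast
  have "(\<integral>\<^sup>+\<omega>. w \<omega> * ?X \<omega> \<partial>M)
      \<le> (\<integral>\<^sup>+\<omega>. w \<omega> * 0 * 0 \<partial>M) + (\<integral>\<^sup>+\<omega>. w \<omega> * ennreal (\<gamma>\<^sub>l * neg_curv (x k \<omega>)) \<partial>M)"
  proof (rule nn_integral_le_of_nn_cond_exp_le)
    show "AE \<omega> in M. nn_cond_exp M (history k) ?X \<omega>
        \<le> 0 * nn_cond_exp M (history k) (\<lambda>_. 0) \<omega> + ennreal (\<gamma>\<^sub>l * neg_curv (x k \<omega>))"
      using B_eigenvalue[of k] by (simp add: Let_def abs_min_eigenvalue_hess)
  qed measurable
  also have "(\<integral>\<^sup>+\<omega>. w \<omega> * ?X \<omega> \<partial>M) = (\<integral>\<^sup>+\<omega>. w \<omega> * ennreal \<bar>curv k \<omega> - neg_curv (x k \<omega>)\<bar> \<partial>M)"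
    by (rule nn_integral_cong) (simp add: X)
  finally show ?thesis by simp
qed

lemma integrable_eigenvalue_error: "integrable M (\<lambda>\<omega>. \<bar>curv k \<omega> - neg_curv (x k \<omega>)\<bar>)"
proof (rule integrableI_nonneg)
  have "integrable M (\<lambda>\<omega>. \<gamma>\<^sub>l * neg_curv (x k \<omega>))"
    using integrable_neg_curv by simp
  then have "(\<integral>\<^sup>+\<omega>. ennreal (\<gamma>\<^sub>l * neg_curv (x k \<omega>)) \<partial>M) < \<infinity>"
    by (subst nn_integral_eq_integral) (auto simp: \<gamma>\<^sub>l_nonneg neg_curv_nonneg)
  then show "(\<integral>\<^sup>+\<omega>. ennreal \<bar>curv k \<omega> - neg_curv (x k \<omega>)\<bar> \<partial>M) < \<infinity>"
    using nn_eigenvalue_error[of "\<lambda>_. 1" k] by (simp add: le_less_trans)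
qed auto

lemma integrable_curv: "integrable M (curv k)"
proof -
  have "integrable M (\<lambda>\<omega>. curv k \<omega> - neg_curv (x k \<omega>))"
    using integrable_eigenvalue_error[of k] by (subst (asm) integrable_abs_iff) auto
  from Bochner_Integration.integrable_add[OF this integrable_neg_curv[of k]] show ?thesis
    by simp
qed

text \<open>
  Condition (B) says that the conditional mean of \<open>|l - L|\<close> is at most \<open>\<gamma>\<^sub>l L\<close>, so that of \<open>l\<close> is at
  least \<open>(1 - \<gamma>\<^sub>l) L\<close>. The statement tests this against bounded weights known to the past.
\<close>

lemma mean_curv_lower_bound:
  fixes w :: "'a \<Rightarrow> real"
  assumes w [measurable]: "w \<in> borel_measurable (history k)" and w_bounds: "\<And>\<omega>. 0 \<le> w \<omega>" "\<And>\<omega>. w \<omega> \<le> C"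
  shows "(1 - \<gamma>\<^sub>l) * (\<integral>\<omega>. w \<omega> * neg_curv (x k \<omega>) \<partial>M) \<le> (\<integral>\<omega>. w \<omega> * curv k \<omega> \<partial>M)"
    and "integrable M (\<lambda>\<omega>. w \<omega> * neg_curv (x k \<omega>))"
    and "integrable M (\<lambda>\<omega>. w \<omega> * curv k \<omega>)"
proof -
  interpret finite_measure_subalgebra M "history k" by (rule subalgebra_history)
  have [measurable]: "w \<in> borel_measurable M"
    by (rule measurable_from_subalg[OF subalg w])
  have int: "integrable M (\<lambda>\<omega>. w \<omega> * h \<omega>)" if h: "integrable M h" for h
  proof (rule Bochner_Integration.integrable_bound)
    show "integrable M (\<lambda>\<omega>. C * h \<omega>)" using h by simp
    show "(\<lambda>\<omega>. w \<omega> * h \<omega>) \<in> borel_measurable M" using h by measurable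
    show "AE \<omega> in M. norm (w \<omega> * h \<omega>) \<le> norm (C * h \<omega>)"
    proof (rule AE_I2)
      fix \<omega>
      have "\<bar>w \<omega>\<bar> \<le> \<bar>C\<bar>"
        using w_bounds[of \<omega>] by simp
      then show "norm (w \<omega> * h \<omega>) \<le> norm (C * h \<omega>)"
        by (simp add: abs_mult mult_right_mono)
    qed
  qed
  note int1 = int[OF integrable_neg_curv[of k]] and int2 = int[OF integrable_curv[of k]]
    and int3 = int[OF integrable_eigenvalue_error[of k]]
  have "ennreal (\<integral>\<omega>. w \<omega> * \<bar>curv k \<omega> - neg_curv (x k \<omega>)\<bar> \<partial>M)
      = (\<integral>\<^sup>+\<omega>. ennreal (w \<omega>) * ennreal \<bar>curv k \<omega> - neg_curv (x k \<omega>)\<bar> \<partial>M)"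
    using w_bounds int3 by (subst nn_integral_eq_integral[symmetric]) (auto simp: ennreal_mult)
  also have "\<dots> \<le> (\<integral>\<^sup>+\<omega>. ennreal (w \<omega>) * ennreal (\<gamma>\<^sub>l * neg_curv (x k \<omega>)) \<partial>M)"
    by (rule nn_eigenvalue_error) measurable
  also have "\<dots> = ennreal (\<integral>\<omega>. \<gamma>\<^sub>l * (w \<omega> * neg_curv (x k \<omega>)) \<partial>M)"
    using w_bounds int1 \<gamma>\<^sub>l_nonneg neg_curv_nonneg
    by (subst nn_integral_eq_integral[symmetric]) (auto simp: ennreal_mult[symmetric] ac_simps)
  finally have "(\<integral>\<omega>. w \<omega> * \<bar>curv k \<omega> - neg_curv (x k \<omega>)\<bar> \<partial>M) \<le> \<gamma>\<^sub>l * (\<integral>\<omega>. w \<omega> * neg_curv (x k \<omega>) \<partial>M)"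
    using w_bounds neg_curv_nonneg \<gamma>\<^sub>l_nonneg
    by (subst (asm) ennreal_le_iff) (auto intro!: Bochner_Integration.integral_nonneg)
  moreover have "(\<integral>\<omega>. w \<omega> * neg_curv (x k \<omega>) \<partial>M) - (\<integral>\<omega>. w \<omega> * curv k \<omega> \<partial>M)
      \<le> (\<integral>\<omega>. w \<omega> * \<bar>curv k \<omega> - neg_curv (x k \<omega>)\<bar> \<partial>M)"
    unfolding Bochner_Integration.integral_diff[OF int1 int2, symmetric]
  proof (rule integral_mono[OF Bochner_Integration.integrable_diff[OF int1 int2] int3])
    fix \<omega>
    have "w \<omega> * (neg_curv (x k \<omega>) - curv k \<omega>) \<le> w \<omega> * \<bar>curv k \<omega> - neg_curv (x k \<omega>)\<bar>"
      by (intro mult_left_mono w_bounds) simp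
    then show "w \<omega> * neg_curv (x k \<omega>) - w \<omega> * curv k \<omega> \<le> w \<omega> * \<bar>curv k \<omega> - neg_curv (x k \<omega>)\<bar>"
      by (simp add: right_diff_distrib)
  qed
  ultimately show "(1 - \<gamma>\<^sub>l) * (\<integral>\<omega>. w \<omega> * neg_curv (x k \<omega>) \<partial>M) \<le> (\<integral>\<omega>. w \<omega> * curv k \<omega> \<partial>M)"
    by (simp add: left_diff_distrib)
  show "integrable M (\<lambda>\<omega>. w \<omega> * neg_curv (x k \<omega>))" by (rule int1)
  show "integrable M (\<lambda>\<omega>. w \<omega> * curv k \<omega>)" by (rule int2)
qed

section \<open>The curvature step\<close>

text \<open>
  The sign of \<open>p k\<close> is chosen to make \<open>g k \<bullet> p k = - |g k \<bullet> q k|\<close>.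
\<close>

lemma grad_inner_p_le:
  assumes "\<omega> \<in> space M"
  shows "grad f (x k \<omega>) \<bullet> p k \<omega> + \<bar>g k \<omega> \<bullet> q k \<omega>\<bar> \<le> \<bar>(g k \<omega> - grad f (x k \<omega>)) \<bullet> q k \<omega>\<bar>"
  using p_eq[OF assms, of k] by (auto simp: inner_diff_left abs_if)

text \<open>
  By \<open>grad_inner_p_le\<close> and condition (A), the conditional mean of \<open>\<nabla>f \<bullet> p\<close> given the past and \<open>q\<close> is
  at most \<open>\<theta>\<^sup>2 - 1\<close> times that of \<open>|g \<bullet> q|\<close>, plus \<open>\<sigma>\<^sup>2\<close>; and \<open>\<theta> < 1\<close>. Positive and negative parts of
  \<open>\<nabla>f \<bullet> p\<close> stand on different sides, so that no integrability is presupposed.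
\<close>

lemma mean_grad_inner_p:
  assumes A: "A \<in> sets (history k)"
  shows "(\<integral>\<^sup>+\<omega>. indicator A \<omega> * ennreal (grad f (x k \<omega>) \<bullet> p k \<omega>) \<partial>M)
    \<le> (\<integral>\<^sup>+\<omega>. indicator A \<omega> * ennreal (- (grad f (x k \<omega>) \<bullet> p k \<omega>)) \<partial>M) + ennreal ((\<sigma> k)\<^sup>2)"
    (is "_ \<le> ?N + _")
proof -
  interpret finite_measure_subalgebra M "history_direction k"
    by (rule subalgebra_history_direction)
  define G where "G \<omega> = grad f (x k \<omega>) \<bullet> p k \<omega>" for \<omega>
  define Y where "Y \<omega> = ennreal \<bar>g k \<omega> \<bullet> q k \<omega>\<bar>" for \<omega>
  define E where "E \<omega> = ennreal \<bar>(g k \<omega> - grad f (x k \<omega>)) \<bullet> q k \<omega>\<bar>" for \<omega>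
  have [measurable]: "G \<in> borel_measurable M" "Y \<in> borel_measurable M" "E \<in> borel_measurable M"
    unfolding G_def[abs_def] Y_def[abs_def] E_def[abs_def] by measurable
  have AF [measurable]: "A \<in> sets (history_direction k)" and AM [measurable]: "A \<in> sets M"
    using A sets_history[of k] by auto
  have AE_cond: "AE \<omega> in M. nn_cond_exp M (history_direction k) Y \<omega> < \<infinity> \<and>
      nn_cond_exp M (history_direction k) E \<omega>
        \<le> ennreal (\<theta>\<^sup>2) * nn_cond_exp M (history_direction k) Y \<omega> + ennreal ((\<sigma> k)\<^sup>2)"
    using A_gradient[of k] unfolding Let_def Y_def[abs_def] E_def[abs_def] .
  have "(\<integral>\<^sup>+\<omega>. indicator A \<omega> * ennreal (G \<omega>) \<partial>M)
      \<le> (\<integral>\<^sup>+\<omega>. indicator A \<omega> * ennreal (- G \<omega>) \<partial>M) + ennreal ((\<sigma> k)\<^sup>2)" (is "_ \<le> ?K")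
  proof (rule nn_integral_le_by_localization)
    show "AE \<omega> in M. nn_cond_exp M (history_direction k) Y \<omega> < \<infinity>"
      using AE_cond by eventually_elim simp
  next
    fix B assume BF [measurable]: "B \<in> sets (history_direction k)"
      and fin: "(\<integral>\<^sup>+\<omega>. indicator B \<omega> * Y \<omega> \<partial>M) < \<infinity>"
    have [measurable]: "B \<in> sets M"
      using BF subalg by (auto simp: subalgebra_def)
    define w :: "'a \<Rightarrow> ennreal" where "w \<omega> = indicator B \<omega> * indicator A \<omega>" for \<omega>
    have [measurable]: "w \<in> borel_measurable (history_direction k)" "w \<in> borel_measurable M"
      unfolding w_def[abs_def] by measurable
    have w_le: "w \<omega> \<le> 1" "w \<omega> \<le> indicator B \<omega>" "w \<omega> \<le> indicator A \<omega>" for \<omega>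
      by (auto simp: w_def indicator_def)
    have "\<theta>\<^sup>2 \<le> 1"
      using \<theta>_nonneg \<theta>_less by (simp add: abs_square_le_1)
    then have "ennreal (\<theta>\<^sup>2) \<le> 1"
      by simp
    then have \<theta>w: "w \<omega> * ennreal (\<theta>\<^sup>2) \<le> w \<omega>" for \<omega>
      using mult_left_mono[of "ennreal (\<theta>\<^sup>2)" 1 "w \<omega>"] by simp
    have "(\<integral>\<^sup>+\<omega>. w \<omega> * Y \<omega> \<partial>M) \<le> (\<integral>\<^sup>+\<omega>. indicator B \<omega> * Y \<omega> \<partial>M)"
      by (intro nn_integral_mono mult_right_mono w_le) simp
    then have fin_w: "(\<integral>\<^sup>+\<omega>. w \<omega> * Y \<omega> \<partial>M) \<noteq> \<infinity>"
      using fin by auto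
    have "(\<integral>\<^sup>+\<omega>. w \<omega> * Y \<omega> \<partial>M) + (\<integral>\<^sup>+\<omega>. w \<omega> * ennreal (G \<omega>) \<partial>M)
        = (\<integral>\<^sup>+\<omega>. w \<omega> * Y \<omega> + w \<omega> * ennreal (G \<omega>) \<partial>M)"
      by (rule nn_integral_add[symmetric]) measurable
    also have "\<dots> \<le> (\<integral>\<^sup>+\<omega>. w \<omega> * E \<omega> + w \<omega> * ennreal (- G \<omega>) \<partial>M)"
    proof (rule nn_integral_mono)
      fix \<omega> assume "\<omega> \<in> space M"
      from grad_inner_p_le[OF this, of k]
      have "Y \<omega> + ennreal (G \<omega>) \<le> E \<omega> + ennreal (- G \<omega>)"
        unfolding Y_def E_def G_def
        by (cases "grad f (x k \<omega>) \<bullet> p k \<omega> \<le> 0")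
          (auto simp: ennreal_neg ennreal_plus[symmetric] simp del: ennreal_plus intro!: ennreal_leI)
      then show "w \<omega> * Y \<omega> + w \<omega> * ennreal (G \<omega>) \<le> w \<omega> * E \<omega> + w \<omega> * ennreal (- G \<omega>)"
        by (simp add: distrib_left[symmetric] mult_left_mono)
    qed
    also have "\<dots> = (\<integral>\<^sup>+\<omega>. w \<omega> * E \<omega> \<partial>M) + (\<integral>\<^sup>+\<omega>. w \<omega> * ennreal (- G \<omega>) \<partial>M)"
      by (rule nn_integral_add) measurable
    also have "(\<integral>\<^sup>+\<omega>. w \<omega> * E \<omega> \<partial>M)
        \<le> (\<integral>\<^sup>+\<omega>. w \<omega> * ennreal (\<theta>\<^sup>2) * Y \<omega> \<partial>M) + (\<integral>\<^sup>+\<omega>. w \<omega> * ennreal ((\<sigma> k)\<^sup>2) \<partial>M)"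
    proof (rule nn_integral_le_of_nn_cond_exp_le)
      show "AE \<omega> in M. nn_cond_exp M (history_direction k) E \<omega>
          \<le> ennreal (\<theta>\<^sup>2) * nn_cond_exp M (history_direction k) Y \<omega> + ennreal ((\<sigma> k)\<^sup>2)"
        using AE_cond by eventually_elim simp
    qed measurable
    also have "(\<integral>\<^sup>+\<omega>. w \<omega> * ennreal (\<theta>\<^sup>2) * Y \<omega> \<partial>M) \<le> (\<integral>\<^sup>+\<omega>. w \<omega> * Y \<omega> \<partial>M)"
      by (intro nn_integral_mono mult_right_mono \<theta>w) simp
    also have "(\<integral>\<^sup>+\<omega>. w \<omega> * ennreal ((\<sigma> k)\<^sup>2) \<partial>M) \<le> (\<integral>\<^sup>+\<omega>. ennreal ((\<sigma> k)\<^sup>2) \<partial>M)"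
      using mult_right_mono[OF w_le(1), of "ennreal ((\<sigma> k)\<^sup>2)"] by (intro nn_integral_mono) simp
    also have "\<dots> = ennreal ((\<sigma> k)\<^sup>2)"
      by (simp add: emeasure_space_1)
    also have "(\<integral>\<^sup>+\<omega>. w \<omega> * ennreal (- G \<omega>) \<partial>M) \<le> (\<integral>\<^sup>+\<omega>. indicator A \<omega> * ennreal (- G \<omega>) \<partial>M)"
      by (intro nn_integral_mono mult_right_mono w_le) simp
    finally have "(\<integral>\<^sup>+\<omega>. w \<omega> * Y \<omega> \<partial>M) + (\<integral>\<^sup>+\<omega>. w \<omega> * ennreal (G \<omega>) \<partial>M)
        \<le> (\<integral>\<^sup>+\<omega>. w \<omega> * Y \<omega> \<partial>M) + ?K"
      by (simp add: add_mono add.assoc add.commute[of "ennreal ((\<sigma> k)\<^sup>2)"])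
    \<comment> \<open>The localization to \<open>B\<close> serves to make the cancelled integral finite.\<close>
    then have "(\<integral>\<^sup>+\<omega>. w \<omega> * ennreal (G \<omega>) \<partial>M) \<le> ?K"
      using fin_w by (simp add: ennreal_add_left_cancel_le)
    then show "(\<integral>\<^sup>+\<omega>. indicator B \<omega> * (indicator A \<omega> * ennreal (G \<omega>)) \<partial>M) \<le> ?K"
      by (simp add: w_def mult.assoc)
  qed measurable
  then show ?thesis by (simp add: G_def)
qed

text \<open>
  For \<open>a = 0\<close> the second coefficient is infinite, and the bound still holds. This avoids a
  separate treatment of the points where the weight \<open>a\<close> vanishes.
\<close>

lemma product_le_weighted_squares:
  fixes r s a :: real
  assumes "0 \<le> r" "0 \<le> s" "0 \<le> a"
  shows "ennreal (r * s) \<le> ennreal (a / 2 * r\<^sup>2) + inverse (ennreal (2 * a)) * ennreal (s\<^sup>2)"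
proof (cases "a = 0")
  case True
  then show ?thesis
    using assms by (cases "s = 0") (auto simp: ennreal_top_mult)
next
  case False
  then have a: "0 < a" using assms by simp
  have "r * s \<le> a / 2 * r\<^sup>2 + inverse (2 * a) * s\<^sup>2"
  proof -
    have "0 \<le> (a * r - s)\<^sup>2 / (2 * a)"
      using a by simp
    also have "\<dots> = a / 2 * r\<^sup>2 + inverse (2 * a) * s\<^sup>2 - r * s"
      using a by (simp add: field_simps power2_eq_square)
    finally show ?thesis by simp
  qed
  then have "ennreal (r * s) \<le> ennreal (a / 2 * r\<^sup>2 + inverse (2 * a) * s\<^sup>2)"
    by (rule ennreal_leI)
  also have "\<dots> = ennreal (a / 2 * r\<^sup>2) + inverse (ennreal (2 * a)) * ennreal (s\<^sup>2)"
  proof -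
    have "inverse (ennreal (2 * a)) * ennreal (s\<^sup>2) = ennreal (inverse (2 * a) * s\<^sup>2)"
      using a by (subst inverse_ennreal, simp, subst ennreal_mult[symmetric], auto)
    moreover have "0 \<le> inverse (2 * a) * s\<^sup>2" "0 \<le> a / 2 * r\<^sup>2"
      using a by simp_all
    ultimately show ?thesis
      by (simp only: ennreal_plus)
  qed
  finally show ?thesis .
qed

text \<open>
  A Cauchy--Schwarz inequality for conditional expectations, in the form of the weighted
  arithmetic--geometric mean inequality. With weight \<open>a = \<gamma>\<^sub>H L\<close>, which is known to the past, both
  halves are equal under the bound of condition (B).
\<close>

lemma mean_hess_error_p:
  assumes A: "A \<in> sets (history k)"
  shows "(\<integral>\<^sup>+\<omega>. indicator A \<omega> * ennreal (norm (p k \<omega>) * norm ((H k \<omega> - hess f (x k \<omega>)) *v p k \<omega>)) \<partial>M)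
    \<le> (\<integral>\<^sup>+\<omega>. indicator A \<omega> * ennreal (\<gamma>\<^sub>H * neg_curv (x k \<omega>) * (norm (p k \<omega>))\<^sup>2) \<partial>M)"
proof -
  interpret finite_measure_subalgebra M "history k" by (rule subalgebra_history)
  have [measurable]: "A \<in> sets (history k)" "A \<in> sets M"
    using A sets_history[of k] by auto
  define a where "a \<omega> = \<gamma>\<^sub>H * neg_curv (x k \<omega>)" for \<omega>
  have a_meas [measurable]: "a \<in> borel_measurable (history k)" "a \<in> borel_measurable M"
    unfolding a_def[abs_def] by measurable
  have a: "0 \<le> a \<omega>" for \<omega>
    by (simp add: a_def \<gamma>\<^sub>H_nonneg neg_curv_nonneg)
  define w where "w \<omega> = indicator A \<omega> * inverse (ennreal (2 * a \<omega>))" for \<omega>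
  have [measurable]: "w \<in> borel_measurable (history k)" "w \<in> borel_measurable M"
    unfolding w_def[abs_def] by measurable
  define P where "P \<omega> = ennreal ((norm (p k \<omega>))\<^sup>2)" for \<omega>
  define D where "D \<omega> = ennreal ((norm ((H k \<omega> - hess f (x k \<omega>)) *v p k \<omega>))\<^sup>2)" for \<omega>
  have [measurable]: "P \<in> borel_measurable M" "D \<in> borel_measurable M"
    unfolding P_def[abs_def] D_def[abs_def] by measurable
  let ?h = "\<lambda>\<omega>. indicator A \<omega> * ennreal (a \<omega> / 2 * (norm (p k \<omega>))\<^sup>2)"
  have "(\<integral>\<^sup>+\<omega>. indicator A \<omega> * ennreal (norm (p k \<omega>) * norm ((H k \<omega> - hess f (x k \<omega>)) *v p k \<omega>)) \<partial>M)
      \<le> (\<integral>\<^sup>+\<omega>. ?h \<omega> + w \<omega> * D \<omega> \<partial>M)"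
  proof (rule nn_integral_mono)
    fix \<omega>
    show "indicator A \<omega> * ennreal (norm (p k \<omega>) * norm ((H k \<omega> - hess f (x k \<omega>)) *v p k \<omega>)) \<le> ?h \<omega> + w \<omega> * D \<omega>"
      using product_le_weighted_squares[OF norm_ge_zero norm_ge_zero a]
      by (auto simp: w_def D_def indicator_def)
  qed
  also have "\<dots> = (\<integral>\<^sup>+\<omega>. ?h \<omega> \<partial>M) + (\<integral>\<^sup>+\<omega>. w \<omega> * D \<omega> \<partial>M)"
    by (rule nn_integral_add) measurable
  also have "(\<integral>\<^sup>+\<omega>. w \<omega> * D \<omega> \<partial>M)
      \<le> (\<integral>\<^sup>+\<omega>. w \<omega> * ennreal ((a \<omega>)\<^sup>2) * P \<omega> \<partial>M) + (\<integral>\<^sup>+\<omega>. w \<omega> * 0 \<partial>M)"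
  proof (rule nn_integral_le_of_nn_cond_exp_le)
    show "AE \<omega> in M. nn_cond_exp M (history k) D \<omega> \<le> ennreal ((a \<omega>)\<^sup>2) * nn_cond_exp M (history k) P \<omega> + 0"
      using B_hessian[of k]
      by (simp add: Let_def abs_min_eigenvalue_hess P_def[abs_def] D_def[abs_def] a_def power_mult_distrib)
  qed measurable
  also have "(\<integral>\<^sup>+\<omega>. w \<omega> * ennreal ((a \<omega>)\<^sup>2) * P \<omega> \<partial>M) \<le> (\<integral>\<^sup>+\<omega>. ?h \<omega> \<partial>M)"
  proof (rule nn_integral_mono)
    fix \<omega>
    have "inverse (ennreal (2 * a \<omega>)) * ennreal ((a \<omega>)\<^sup>2) = ennreal (a \<omega> / 2)"
    proof (cases "a \<omega> = 0")
      case False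
      then have "0 < a \<omega>" using a[of \<omega>] by simp
      then show ?thesis
        by (subst inverse_ennreal, simp, subst ennreal_mult[symmetric])
          (auto simp: power2_eq_square field_simps)
    qed simp
    then have "w \<omega> * ennreal ((a \<omega>)\<^sup>2) * P \<omega> = indicator A \<omega> * (ennreal (a \<omega> / 2) * P \<omega>)"
      by (simp only: w_def mult.assoc)
    also have "ennreal (a \<omega> / 2) * P \<omega> = ennreal (a \<omega> / 2 * (norm (p k \<omega>))\<^sup>2)"
      unfolding P_def using a[of \<omega>] by (subst ennreal_mult) auto
    finally show "w \<omega> * ennreal ((a \<omega>)\<^sup>2) * P \<omega> \<le> ?h \<omega>"
      by simp
  qed
  also have "(\<integral>\<^sup>+\<omega>. ?h \<omega> \<partial>M) + ((\<integral>\<^sup>+\<omega>. ?h \<omega> \<partial>M) + (\<integral>\<^sup>+\<omega>. w \<omega> * 0 \<partial>M)) = (\<integral>\<^sup>+\<omega>. ?h \<omega> + ?h \<omega> \<partial>M)"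
    by (subst nn_integral_add) auto
  also have "\<dots> = (\<integral>\<^sup>+\<omega>. indicator A \<omega> * ennreal (a \<omega> * (norm (p k \<omega>))\<^sup>2) \<partial>M)"
    using a by (intro nn_integral_cong)
      (auto simp: distrib_left[symmetric] ennreal_plus[symmetric] simp del: ennreal_plus)
  finally show ?thesis
    by (simp add: a_def add_left_mono)
qed

text \<open>
  Half of the coefficient of \<open>l\<^sup>3\<close> that remains in the decrease of the curvature step when the
  third-order term of the model is dropped; the bound on \<open>\<beta>\<close> lets the third-order term
  consume at most the other half.
\<close>

definition curvature_rate :: real where
  "curvature_rate = \<beta>\<^sup>2 * \<delta>\<^sup>2 * (\<gamma> - \<gamma>\<^sub>H / (1 - \<gamma>\<^sub>l)) / 4"

lemma curvature_rate_pos: "0 < curvature_rate"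
  using \<gamma>\<^sub>l_less \<gamma>\<^sub>H_less \<beta>_pos \<delta>_pos by (simp add: curvature_rate_def pos_divide_less_eq)

lemma curvature_rate_le:
  "curvature_rate + \<beta>\<^sup>2 / 2 * (\<gamma>\<^sub>H * \<delta>\<^sup>2 / (1 - \<gamma>\<^sub>l)) \<le> \<beta>\<^sup>2 * \<delta>\<^sup>2 / 2 * (\<gamma> - L\<^sub>H * \<beta> * \<delta> / 3)"
proof -
  define r where "r = \<gamma>\<^sub>H / (1 - \<gamma>\<^sub>l)"
  define c where "c = \<gamma> - r"
  have "\<beta> * (2 * \<delta> * L\<^sub>H) \<le> 3 * c"
    using \<beta>_le \<delta>_pos L\<^sub>H_pos by (simp add: pos_le_divide_eq c_def r_def)
  then have "c / 2 \<le> c - L\<^sub>H * \<beta> * \<delta> / 3"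
    by (simp add: algebra_simps)
  then have "\<beta>\<^sup>2 * \<delta>\<^sup>2 / 2 * (c / 2) \<le> \<beta>\<^sup>2 * \<delta>\<^sup>2 / 2 * (c - L\<^sub>H * \<beta> * \<delta> / 3)"
    by (intro mult_left_mono) auto
  moreover have rate: "curvature_rate = \<beta>\<^sup>2 * \<delta>\<^sup>2 / 2 * (c / 2)" "\<gamma>\<^sub>H * \<delta>\<^sup>2 / (1 - \<gamma>\<^sub>l) = r * \<delta>\<^sup>2"
    by (simp_all add: curvature_rate_def c_def r_def)
  ultimately show ?thesis
    unfolding rate by (simp add: c_def algebra_simps)
qed

text \<open>
  The cubic upper model at \<open>x k\<close>, with the Hessian replaced by its approximation at the cost of the
  last term.
\<close>

lemma curvature_step_pointwise:
  assumes \<omega>: "\<omega> \<in> space M"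
  shows "gap (xh k \<omega>) + \<beta>\<^sup>2 * \<delta>\<^sup>2 / 2 * (\<gamma> - L\<^sub>H * \<beta> * \<delta> / 3) * curv k \<omega> ^ 3
    \<le> gap (x k \<omega>) + \<beta> * (grad f (x k \<omega>) \<bullet> p k \<omega>)
      + \<beta>\<^sup>2 / 2 * (norm (p k \<omega>) * norm ((H k \<omega> - hess f (x k \<omega>)) *v p k \<omega>))"
proof -
  define D where "D = (H k \<omega> - hess f (x k \<omega>)) *v p k \<omega>"
  have "hess f (x k \<omega>) *v p k \<omega> = H k \<omega> *v p k \<omega> - D"
    by (simp add: D_def matrix_vector_mult_diff_rdistrib)
  then have "p k \<omega> \<bullet> (hess f (x k \<omega>) *v p k \<omega>) = p k \<omega> \<bullet> (H k \<omega> *v p k \<omega>) - p k \<omega> \<bullet> D"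
    by (simp add: inner_diff_right)
  also have "\<dots> \<le> - (\<gamma> * \<delta>\<^sup>2 * curv k \<omega> ^ 3) + norm (p k \<omega>) * norm D"
    using curvature_along_p[OF \<omega>, of k] Cauchy_Schwarz_ineq2[of "p k \<omega>" D] by linarith
  finally have "\<beta>\<^sup>2 / 2 * (p k \<omega> \<bullet> (hess f (x k \<omega>) *v p k \<omega>))
      \<le> \<beta>\<^sup>2 / 2 * (- (\<gamma> * \<delta>\<^sup>2 * curv k \<omega> ^ 3) + norm (p k \<omega>) * norm D)"
    by (rule mult_left_mono) simp
  moreover have "f (xh k \<omega>) \<le> f (x k \<omega>) + \<beta> * (grad f (x k \<omega>) \<bullet> p k \<omega>)
      + \<beta>\<^sup>2 / 2 * (p k \<omega> \<bullet> (hess f (x k \<omega>) *v p k \<omega>)) + L\<^sub>H / 6 * (\<beta> * (\<delta> * curv k \<omega>)) ^ 3"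
    using cubic_upper_bound[of "x k \<omega>" "\<beta> *\<^sub>R p k \<omega>"] \<beta>_pos
    by (simp add: curvature_step[OF \<omega>] matrix_vector_mult_scaleR norm_p[OF \<omega>] power2_eq_square)
  ultimately show ?thesis
    unfolding D_def[symmetric]
    by (simp add: algebra_simps power2_eq_square power3_eq_cube add_divide_distrib diff_divide_distrib)
qed

text \<open>
  The decrease of the curvature step on an event of the past on which \<open>\<parallel>p\<parallel>\<^sup>2\<close> is integrable.
  The third power of the curvature is integrable there because the optimality gap at the trial
  point is nonnegative: the pointwise estimate then bounds \<open>l\<^sup>3\<close> by integrable terms. Only after
  that can \<open>L l\<^sup>2\<close> be compared with \<open>l\<^sup>3\<close> in expectation.
\<close>

lemma curvature_step_on:
  assumes A: "A \<in> sets (history k)"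
    and fin: "(\<integral>\<^sup>+\<omega>. indicator A \<omega> * ennreal ((norm (p k \<omega>))\<^sup>2) \<partial>M) < \<infinity>"
    and gap_int: "integrable M (\<lambda>\<omega>. gap (x k \<omega>))"
  shows "(\<integral>\<^sup>+\<omega>. indicator A \<omega> * ennreal (gap (xh k \<omega>) + curvature_rate * curv k \<omega> ^ 3) \<partial>M)
    \<le> ennreal ((\<integral>\<omega>. gap (x k \<omega>) \<partial>M) + \<beta> * (\<sigma> k)\<^sup>2)"
proof -
  have AF [measurable]: "A \<in> sets (history k)" and AM [measurable]: "A \<in> sets M"
    using A sets_history[of k] by auto
  define i :: "'a \<Rightarrow> real" where "i = indicator A"
  have i_meas [measurable]: "i \<in> borel_measurable (history k)" "i \<in> borel_measurable M"
    unfolding i_def by measurable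
  have i: "0 \<le> i \<omega>" "i \<omega> \<le> 1" "i \<omega> * i \<omega> = i \<omega>" "ennreal (i \<omega>) = indicator A \<omega>" for \<omega>
    by (auto simp: i_def indicator_def)
  define G where "G \<omega> = grad f (x k \<omega>) \<bullet> p k \<omega>" for \<omega>
  define W where "W \<omega> = norm (p k \<omega>) * norm ((H k \<omega> - hess f (x k \<omega>)) *v p k \<omega>)" for \<omega>
  define m where "m \<omega> = (1 - \<gamma>\<^sub>l) * neg_curv (x k \<omega>)" for \<omega>
  define \<kappa> where "\<kappa> = \<beta>\<^sup>2 * \<delta>\<^sup>2 / 2 * (\<gamma> - L\<^sub>H * \<beta> * \<delta> / 3)"
  have [measurable]: "G \<in> borel_measurable M" "W \<in> borel_measurable M" "m \<in> borel_measurable M"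
      "m \<in> borel_measurable (history k)"
    unfolding G_def[abs_def] W_def[abs_def] m_def[abs_def] by measurable
  have W_nonneg: "0 \<le> W \<omega>" for \<omega>
    by (simp add: W_def)
  have m_bounds: "0 \<le> m \<omega>" "m \<omega> \<le> L\<^sub>g" for \<omega>
  proof -
    show "0 \<le> m \<omega>"
      using \<gamma>\<^sub>l_less by (simp add: m_def neg_curv_nonneg)
    have "m \<omega> \<le> 1 * neg_curv (x k \<omega>)"
      unfolding m_def using \<gamma>\<^sub>l_nonneg by (intro mult_right_mono neg_curv_nonneg) simp
    then show "m \<omega> \<le> L\<^sub>g"
      using neg_curv_le[of "x k \<omega>"] by simp
  qed
  have \<kappa>: "curvature_rate + \<beta>\<^sup>2 / 2 * (\<gamma>\<^sub>H * \<delta>\<^sup>2 / (1 - \<gamma>\<^sub>l)) \<le> \<kappa>"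
    unfolding \<kappa>_def by (rule curvature_rate_le)
  have \<kappa>_pos: "0 < \<kappa>"
  proof -
    have "0 \<le> \<beta>\<^sup>2 / 2 * (\<gamma>\<^sub>H * \<delta>\<^sup>2 / (1 - \<gamma>\<^sub>l))"
      using \<gamma>\<^sub>H_nonneg \<gamma>\<^sub>l_less by simp
    then show ?thesis using \<kappa> curvature_rate_pos by linarith
  qed

  have p_int: "integrable M (\<lambda>\<omega>. i \<omega> * (norm (p k \<omega>))\<^sup>2)"
  proof (rule integrableI_nonneg)
    show "(\<integral>\<^sup>+\<omega>. ennreal (i \<omega> * (norm (p k \<omega>))\<^sup>2) \<partial>M) < \<infinity>"
      using fin by (simp add: ennreal_mult i)
  qed (auto simp: i)
  have grad_int: "integrable M (\<lambda>\<omega>. (norm (grad f (x k \<omega>)))\<^sup>2)"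
  proof (rule Bochner_Integration.integrable_bound)
    show "integrable M (\<lambda>\<omega>. 2 * L\<^sub>g * gap (x k \<omega>))"
      using gap_int by (intro integrable_mult_right)
    show "AE \<omega> in M. norm ((norm (grad f (x k \<omega>)))\<^sup>2) \<le> norm (2 * L\<^sub>g * gap (x k \<omega>))"
      using norm_grad_sq_le abs_ge_self by (intro AE_I2) (force intro: order.trans)
  qed measurable
  have G_int: "integrable M (\<lambda>\<omega>. i \<omega> * G \<omega>)"
  proof (rule Bochner_Integration.integrable_bound)
    show "integrable M (\<lambda>\<omega>. (norm (grad f (x k \<omega>)))\<^sup>2 + i \<omega> * (norm (p k \<omega>))\<^sup>2)"
      using grad_int p_int by simp
    show "AE \<omega> in M. norm (i \<omega> * G \<omega>) \<le> norm ((norm (grad f (x k \<omega>)))\<^sup>2 + i \<omega> * (norm (p k \<omega>))\<^sup>2)"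
    proof (rule AE_I2)
      fix \<omega>
      have "\<bar>G \<omega>\<bar> \<le> norm (grad f (x k \<omega>)) * norm (p k \<omega>)"
        unfolding G_def by (rule Cauchy_Schwarz_ineq2)
      also have "\<dots> \<le> (norm (grad f (x k \<omega>)))\<^sup>2 + (norm (p k \<omega>))\<^sup>2"
        using sum_squares_bound[of "norm (grad f (x k \<omega>))" "norm (p k \<omega>)"]
          mult_nonneg_nonneg[OF norm_ge_zero[of "grad f (x k \<omega>)"] norm_ge_zero[of "p k \<omega>"]]
        by linarith
      finally show "norm (i \<omega> * G \<omega>) \<le> norm ((norm (grad f (x k \<omega>)))\<^sup>2 + i \<omega> * (norm (p k \<omega>))\<^sup>2)"
        by (auto simp: i_def indicator_def)
    qed
  qed measurable
  have G_mean: "(\<integral>\<omega>. i \<omega> * G \<omega> \<partial>M) \<le> (\<sigma> k)\<^sup>2"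
  proof -
    have "ennreal (\<integral>\<omega>. max (i \<omega> * G \<omega>) 0 \<partial>M) = (\<integral>\<^sup>+\<omega>. ennreal (max (i \<omega> * G \<omega>) 0) \<partial>M)"
      using G_int by (intro nn_integral_eq_integral[symmetric]) auto
    also have "\<dots> = (\<integral>\<^sup>+\<omega>. indicator A \<omega> * ennreal (G \<omega>) \<partial>M)"
      by (intro nn_integral_cong) (auto simp: i_def indicator_def)
    also have "\<dots> \<le> (\<integral>\<^sup>+\<omega>. indicator A \<omega> * ennreal (- G \<omega>) \<partial>M) + ennreal ((\<sigma> k)\<^sup>2)"
      unfolding G_def by (rule mean_grad_inner_p[OF A])
    also have "(\<integral>\<^sup>+\<omega>. indicator A \<omega> * ennreal (- G \<omega>) \<partial>M) = (\<integral>\<^sup>+\<omega>. ennreal (max (- (i \<omega> * G \<omega>)) 0) \<partial>M)"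
      by (intro nn_integral_cong) (auto simp: i_def indicator_def)
    also have "\<dots> = ennreal (\<integral>\<omega>. max (- (i \<omega> * G \<omega>)) 0 \<partial>M)"
      using G_int by (intro nn_integral_eq_integral) auto
    also have "\<dots> + ennreal ((\<sigma> k)\<^sup>2) = ennreal ((\<integral>\<omega>. max (- (i \<omega> * G \<omega>)) 0 \<partial>M) + (\<sigma> k)\<^sup>2)"
      by (intro ennreal_plus[symmetric] Bochner_Integration.integral_nonneg) auto
    finally have "(\<integral>\<omega>. max (i \<omega> * G \<omega>) 0 \<partial>M) \<le> (\<integral>\<omega>. max (- (i \<omega> * G \<omega>)) 0 \<partial>M) + (\<sigma> k)\<^sup>2"
      by (subst (asm) ennreal_le_iff) (auto intro!: add_nonneg_nonneg Bochner_Integration.integral_nonneg)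
    moreover have "(\<integral>\<omega>. i \<omega> * G \<omega> \<partial>M)
        = (\<integral>\<omega>. max (i \<omega> * G \<omega>) 0 \<partial>M) - (\<integral>\<omega>. max (- (i \<omega> * G \<omega>)) 0 \<partial>M)"
    proof -
      have "(\<integral>\<omega>. max (i \<omega> * G \<omega>) 0 \<partial>M) - (\<integral>\<omega>. max (- (i \<omega> * G \<omega>)) 0 \<partial>M)
          = (\<integral>\<omega>. max (i \<omega> * G \<omega>) 0 - max (- (i \<omega> * G \<omega>)) 0 \<partial>M)"
        using G_int by (intro Bochner_Integration.integral_diff[symmetric]) auto
      also have "\<dots> = (\<integral>\<omega>. i \<omega> * G \<omega> \<partial>M)"
        by (intro Bochner_Integration.integral_cong) (auto simp: max_def)
      finally show ?thesis by simp
    qed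
    ultimately show ?thesis by simp
  qed

  have aP_int: "integrable M (\<lambda>\<omega>. i \<omega> * (\<gamma>\<^sub>H * neg_curv (x k \<omega>) * (norm (p k \<omega>))\<^sup>2))"
  proof (rule Bochner_Integration.integrable_bound)
    show "integrable M (\<lambda>\<omega>. (\<gamma>\<^sub>H * L\<^sub>g) * (i \<omega> * (norm (p k \<omega>))\<^sup>2))"
      using p_int by (intro integrable_mult_right)
    show "AE \<omega> in M. norm (i \<omega> * (\<gamma>\<^sub>H * neg_curv (x k \<omega>) * (norm (p k \<omega>))\<^sup>2))
        \<le> norm ((\<gamma>\<^sub>H * L\<^sub>g) * (i \<omega> * (norm (p k \<omega>))\<^sup>2))"
    proof (rule AE_I2)
      fix \<omega>
      have "\<gamma>\<^sub>H * neg_curv (x k \<omega>) * (norm (p k \<omega>))\<^sup>2 \<le> \<gamma>\<^sub>H * L\<^sub>g * (norm (p k \<omega>))\<^sup>2"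
        by (intro mult_right_mono mult_left_mono neg_curv_le \<gamma>\<^sub>H_nonneg) auto
      then show "norm (i \<omega> * (\<gamma>\<^sub>H * neg_curv (x k \<omega>) * (norm (p k \<omega>))\<^sup>2))
          \<le> norm ((\<gamma>\<^sub>H * L\<^sub>g) * (i \<omega> * (norm (p k \<omega>))\<^sup>2))"
        using \<gamma>\<^sub>H_nonneg neg_curv_nonneg[of "x k \<omega>"] L\<^sub>g_pos by (auto simp: i_def indicator_def abs_mult)
    qed
  qed measurable
  have W_nn: "(\<integral>\<^sup>+\<omega>. ennreal (i \<omega> * W \<omega>) \<partial>M)
      \<le> ennreal (\<integral>\<omega>. i \<omega> * (\<gamma>\<^sub>H * neg_curv (x k \<omega>) * (norm (p k \<omega>))\<^sup>2) \<partial>M)"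
  proof -
    have "(\<integral>\<^sup>+\<omega>. ennreal (i \<omega> * W \<omega>) \<partial>M) = (\<integral>\<^sup>+\<omega>. indicator A \<omega> * ennreal (W \<omega>) \<partial>M)"
      by (simp add: ennreal_mult i W_nonneg)
    also have "\<dots> \<le> (\<integral>\<^sup>+\<omega>. indicator A \<omega> * ennreal (\<gamma>\<^sub>H * neg_curv (x k \<omega>) * (norm (p k \<omega>))\<^sup>2) \<partial>M)"
      unfolding W_def by (rule mean_hess_error_p[OF A])
    also have "\<dots> = (\<integral>\<^sup>+\<omega>. ennreal (i \<omega> * (\<gamma>\<^sub>H * neg_curv (x k \<omega>) * (norm (p k \<omega>))\<^sup>2)) \<partial>M)"
      by (intro nn_integral_cong) (auto simp: i_def indicator_def)
    also have "\<dots> = ennreal (\<integral>\<omega>. i \<omega> * (\<gamma>\<^sub>H * neg_curv (x k \<omega>) * (norm (p k \<omega>))\<^sup>2) \<partial>M)"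
      using \<gamma>\<^sub>H_nonneg i by (intro nn_integral_eq_integral aP_int) (auto simp: neg_curv_nonneg)
    finally show ?thesis .
  qed
  have W_int: "integrable M (\<lambda>\<omega>. i \<omega> * W \<omega>)"
    using W_nn by (intro integrableI_nonneg) (auto simp: i W_nonneg intro: le_less_trans)
  have W_mean: "(\<integral>\<omega>. i \<omega> * W \<omega> \<partial>M) \<le> (\<integral>\<omega>. i \<omega> * (\<gamma>\<^sub>H * neg_curv (x k \<omega>) * (norm (p k \<omega>))\<^sup>2) \<partial>M)"
    using W_nn W_int \<gamma>\<^sub>H_nonneg neg_curv_nonneg i W_nonneg
    by (subst (asm) nn_integral_eq_integral)
      (auto simp: ennreal_le_iff intro!: Bochner_Integration.integral_nonneg)

  have gapx_int: "integrable M (\<lambda>\<omega>. i \<omega> * gap (x k \<omega>))"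
    unfolding i_def using integrable_real_mult_indicator[OF AM gap_int] by (simp add: mult.commute)
  define R where "R \<omega> = gap (x k \<omega>) + \<beta> * G \<omega> + \<beta>\<^sup>2 / 2 * W \<omega>" for \<omega>
  have iR: "i \<omega> * R \<omega> = i \<omega> * gap (x k \<omega>) + \<beta> * (i \<omega> * G \<omega>) + \<beta>\<^sup>2 / 2 * (i \<omega> * W \<omega>)" for \<omega>
    by (simp add: R_def algebra_simps)
  have R_int: "integrable M (\<lambda>\<omega>. i \<omega> * R \<omega>)"
    unfolding iR
    by (intro Bochner_Integration.integrable_add integrable_mult_right gapx_int G_int W_int)
  \<comment> \<open>As the gap is nonnegative and \<open>\<kappa>\<close> is positive, the integrable \<open>R\<close> dominates both terms on the left.\<close>
  have pointwise: "i \<omega> * gap (xh k \<omega>) + \<kappa> * (i \<omega> * curv k \<omega> ^ 3) \<le> i \<omega> * R \<omega>" if "\<omega> \<in> space M" for \<omega>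
    using mult_left_mono[OF curvature_step_pointwise[OF that, of k] i(1)[of \<omega>]]
    by (simp add: \<kappa>_def R_def G_def W_def algebra_simps)
  have nonneg: "0 \<le> i \<omega> * gap (xh k \<omega>)" "0 \<le> i \<omega> * curv k \<omega> ^ 3" for \<omega>
    using i curv_nonneg[of k \<omega>] gap_nonneg[of "xh k \<omega>"] by simp_all
  have gapxh_int: "integrable M (\<lambda>\<omega>. i \<omega> * gap (xh k \<omega>))"
  proof (rule Bochner_Integration.integrable_bound[OF R_int])
    show "AE \<omega> in M. norm (i \<omega> * gap (xh k \<omega>)) \<le> norm (i \<omega> * R \<omega>)"
    proof (rule AE_I2)
      fix \<omega> assume "\<omega> \<in> space M"
      have "0 \<le> \<kappa> * (i \<omega> * curv k \<omega> ^ 3)"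
        using \<kappa>_pos nonneg(2) by simp
      with pointwise[OF \<open>\<omega> \<in> space M\<close>] nonneg(1)[of \<omega>]
      show "norm (i \<omega> * gap (xh k \<omega>)) \<le> norm (i \<omega> * R \<omega>)" by simp
    qed
  qed measurable
  have curv3_int: "integrable M (\<lambda>\<omega>. i \<omega> * curv k \<omega> ^ 3)"
  proof (rule Bochner_Integration.integrable_bound)
    show "integrable M (\<lambda>\<omega>. 1 / \<kappa> * (i \<omega> * R \<omega>))"
      by (intro integrable_mult_right R_int)
    show "AE \<omega> in M. norm (i \<omega> * curv k \<omega> ^ 3) \<le> norm (1 / \<kappa> * (i \<omega> * R \<omega>))"
    proof (rule AE_I2)
      fix \<omega> assume "\<omega> \<in> space M"
      have "\<kappa> * (i \<omega> * curv k \<omega> ^ 3) \<le> i \<omega> * R \<omega>"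
        using pointwise[OF \<open>\<omega> \<in> space M\<close>] nonneg(1)[of \<omega>] by linarith
      then have "i \<omega> * curv k \<omega> ^ 3 \<le> 1 / \<kappa> * (i \<omega> * R \<omega>)"
        using \<kappa>_pos by (simp add: field_simps)
      then show "norm (i \<omega> * curv k \<omega> ^ 3) \<le> norm (1 / \<kappa> * (i \<omega> * R \<omega>))"
        using nonneg(2)[of \<omega>] unfolding real_norm_def by linarith
    qed
  qed measurable

  have "(\<integral>\<omega>. i \<omega> * (\<gamma>\<^sub>H * neg_curv (x k \<omega>) * (norm (p k \<omega>))\<^sup>2) \<partial>M)
      \<le> \<gamma>\<^sub>H * \<delta>\<^sup>2 / (1 - \<gamma>\<^sub>l) * (\<integral>\<omega>. i \<omega> * curv k \<omega> ^ 3 \<partial>M)"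
  proof -
    \<comment> \<open>The conditional lower bound on the mean of \<open>l\<close> is tested against \<open>m\<^sup>2\<close>.\<close>
    define w where "w \<omega> = i \<omega> * (m \<omega>)\<^sup>2" for \<omega>
    have w_meas [measurable]: "w \<in> borel_measurable (history k)"
      unfolding w_def[abs_def] by measurable
    have w: "0 \<le> w \<omega>" "w \<omega> \<le> L\<^sub>g\<^sup>2" for \<omega>
    proof -
      have "(m \<omega>)\<^sup>2 \<le> L\<^sub>g\<^sup>2"
        by (intro power_mono m_bounds)
      then show "0 \<le> w \<omega>" "w \<omega> \<le> L\<^sub>g\<^sup>2"
        by (auto simp: w_def i_def indicator_def)
    qed
    note lower = mean_curv_lower_bound[OF w_meas w]
    define K where "K = \<gamma>\<^sub>H * \<delta>\<^sup>2 / (1 - \<gamma>\<^sub>l)"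
    have K: "0 \<le> K"
      using \<gamma>\<^sub>H_nonneg \<gamma>\<^sub>l_less by (simp add: K_def)
    have "(\<integral>\<omega>. i \<omega> * (\<gamma>\<^sub>H * neg_curv (x k \<omega>) * (norm (p k \<omega>))\<^sup>2) \<partial>M)
        \<le> (\<integral>\<omega>. K * (i \<omega> * curv k \<omega> ^ 3 + (1 - \<gamma>\<^sub>l) * (w \<omega> * neg_curv (x k \<omega>)) - w \<omega> * curv k \<omega>) \<partial>M)"
    proof (rule integral_mono[OF aP_int])
      show "integrable M (\<lambda>\<omega>. K * (i \<omega> * curv k \<omega> ^ 3 + (1 - \<gamma>\<^sub>l) * (w \<omega> * neg_curv (x k \<omega>)) - w \<omega> * curv k \<omega>))"
        by (intro integrable_mult_right Bochner_Integration.integrable_add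
            Bochner_Integration.integrable_diff curv3_int lower(2,3))
      fix \<omega> assume \<omega>: "\<omega> \<in> space M"
      define l where "l = curv k \<omega>"
      \<comment> \<open>Equivalently \<open>l\<^sup>3 - m l\<^sup>2 \<ge> m\<^sup>2 (l - m)\<close>, whose right-hand side has nonnegative conditional mean.\<close>
      have "0 \<le> (m \<omega> - l)\<^sup>2 * (m \<omega> + l)"
        using m_bounds[of \<omega>] curv_nonneg[of k \<omega>] by (simp add: l_def)
      then have "m \<omega> * l\<^sup>2 \<le> l ^ 3 + m \<omega> ^ 3 - (m \<omega>)\<^sup>2 * l"
        by (simp add: power2_eq_square power3_eq_cube algebra_simps)
      from mult_left_mono[OF this, of "K * i \<omega>"]
      have "K * i \<omega> * (m \<omega> * l\<^sup>2) \<le> K * i \<omega> * (l ^ 3 + m \<omega> ^ 3 - (m \<omega>)\<^sup>2 * l)"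
        using K i by simp
      also have "K * i \<omega> * (m \<omega> * l\<^sup>2) = i \<omega> * (\<gamma>\<^sub>H * neg_curv (x k \<omega>) * (norm (p k \<omega>))\<^sup>2)"
        using \<gamma>\<^sub>l_less by (simp add: norm_p[OF \<omega>] K_def m_def l_def power_mult_distrib)
      also have "K * i \<omega> * (l ^ 3 + m \<omega> ^ 3 - (m \<omega>)\<^sup>2 * l)
          = K * (i \<omega> * curv k \<omega> ^ 3 + (1 - \<gamma>\<^sub>l) * (w \<omega> * neg_curv (x k \<omega>)) - w \<omega> * curv k \<omega>)"
      proof -
        have wm: "(1 - \<gamma>\<^sub>l) * (w \<omega> * neg_curv (x k \<omega>)) = w \<omega> * m \<omega>"
          by (simp add: m_def)
        show ?thesis
          unfolding wm
          by (simp add: l_def w_def power2_eq_square power3_eq_cube algebra_simps)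
      qed
      finally show "i \<omega> * (\<gamma>\<^sub>H * neg_curv (x k \<omega>) * (norm (p k \<omega>))\<^sup>2)
          \<le> K * (i \<omega> * curv k \<omega> ^ 3 + (1 - \<gamma>\<^sub>l) * (w \<omega> * neg_curv (x k \<omega>)) - w \<omega> * curv k \<omega>)" .
    qed
    also have "\<dots> = K * ((\<integral>\<omega>. i \<omega> * curv k \<omega> ^ 3 \<partial>M)
        + (1 - \<gamma>\<^sub>l) * (\<integral>\<omega>. w \<omega> * neg_curv (x k \<omega>) \<partial>M) - (\<integral>\<omega>. w \<omega> * curv k \<omega> \<partial>M))"
      using curv3_int lower(2,3) by simp
    also have "\<dots> \<le> K * (\<integral>\<omega>. i \<omega> * curv k \<omega> ^ 3 \<partial>M)"
      using lower(1) by (intro mult_left_mono K) simp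
    finally show ?thesis by (simp add: K_def)
  qed
  with W_mean have W_le: "(\<integral>\<omega>. i \<omega> * W \<omega> \<partial>M) \<le> \<gamma>\<^sub>H * \<delta>\<^sup>2 / (1 - \<gamma>\<^sub>l) * (\<integral>\<omega>. i \<omega> * curv k \<omega> ^ 3 \<partial>M)"
    by linarith

  have curv3_nonneg: "0 \<le> (\<integral>\<omega>. i \<omega> * curv k \<omega> ^ 3 \<partial>M)"
    by (intro Bochner_Integration.integral_nonneg nonneg)
  have "(\<integral>\<omega>. i \<omega> * gap (xh k \<omega>) \<partial>M) + \<kappa> * (\<integral>\<omega>. i \<omega> * curv k \<omega> ^ 3 \<partial>M)
      = (\<integral>\<omega>. i \<omega> * gap (xh k \<omega>) + \<kappa> * (i \<omega> * curv k \<omega> ^ 3) \<partial>M)"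
    using gapxh_int curv3_int by simp
  also have "\<dots> \<le> (\<integral>\<omega>. i \<omega> * R \<omega> \<partial>M)"
    using gapxh_int curv3_int by (intro integral_mono R_int pointwise) auto
  also have "\<dots> = (\<integral>\<omega>. i \<omega> * gap (x k \<omega>) \<partial>M) + \<beta> * (\<integral>\<omega>. i \<omega> * G \<omega> \<partial>M) + \<beta>\<^sup>2 / 2 * (\<integral>\<omega>. i \<omega> * W \<omega> \<partial>M)"
    unfolding iR using gapx_int G_int W_int by simp
  also have "\<dots> \<le> (\<integral>\<omega>. gap (x k \<omega>) \<partial>M) + \<beta> * (\<sigma> k)\<^sup>2
      + \<beta>\<^sup>2 / 2 * (\<gamma>\<^sub>H * \<delta>\<^sup>2 / (1 - \<gamma>\<^sub>l) * (\<integral>\<omega>. i \<omega> * curv k \<omega> ^ 3 \<partial>M))"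
  proof (intro add_mono mult_left_mono G_mean W_le)
    show "(\<integral>\<omega>. i \<omega> * gap (x k \<omega>) \<partial>M) \<le> (\<integral>\<omega>. gap (x k \<omega>) \<partial>M)"
    proof (rule integral_mono[OF gapx_int gap_int])
      fix \<omega> show "i \<omega> * gap (x k \<omega>) \<le> gap (x k \<omega>)"
        using mult_right_mono[OF i(2) gap_nonneg[of "x k \<omega>"]] by simp
    qed
  qed (use \<beta>_pos in auto)
  finally have "(\<integral>\<omega>. i \<omega> * gap (xh k \<omega>) \<partial>M)
      + (\<kappa> - \<beta>\<^sup>2 / 2 * (\<gamma>\<^sub>H * \<delta>\<^sup>2 / (1 - \<gamma>\<^sub>l))) * (\<integral>\<omega>. i \<omega> * curv k \<omega> ^ 3 \<partial>M)
      \<le> (\<integral>\<omega>. gap (x k \<omega>) \<partial>M) + \<beta> * (\<sigma> k)\<^sup>2"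
    by (simp add: left_diff_distrib)
  moreover have "curvature_rate * (\<integral>\<omega>. i \<omega> * curv k \<omega> ^ 3 \<partial>M)
      \<le> (\<kappa> - \<beta>\<^sup>2 / 2 * (\<gamma>\<^sub>H * \<delta>\<^sup>2 / (1 - \<gamma>\<^sub>l))) * (\<integral>\<omega>. i \<omega> * curv k \<omega> ^ 3 \<partial>M)"
    using \<kappa> by (intro mult_right_mono curv3_nonneg) linarith
  ultimately have le: "(\<integral>\<omega>. i \<omega> * gap (xh k \<omega>) + curvature_rate * (i \<omega> * curv k \<omega> ^ 3) \<partial>M)
      \<le> (\<integral>\<omega>. gap (x k \<omega>) \<partial>M) + \<beta> * (\<sigma> k)\<^sup>2"
    using gapxh_int curv3_int by simp
  have "(\<integral>\<^sup>+\<omega>. indicator A \<omega> * ennreal (gap (xh k \<omega>) + curvature_rate * curv k \<omega> ^ 3) \<partial>M)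
      = (\<integral>\<^sup>+\<omega>. ennreal (i \<omega> * gap (xh k \<omega>) + curvature_rate * (i \<omega> * curv k \<omega> ^ 3)) \<partial>M)"
    by (intro nn_integral_cong) (auto simp: i_def indicator_def)
  also have "\<dots> = ennreal (\<integral>\<omega>. i \<omega> * gap (xh k \<omega>) + curvature_rate * (i \<omega> * curv k \<omega> ^ 3) \<partial>M)"
  proof (rule nn_integral_eq_integral)
    show "integrable M (\<lambda>\<omega>. i \<omega> * gap (xh k \<omega>) + curvature_rate * (i \<omega> * curv k \<omega> ^ 3))"
      using gapxh_int curv3_int by simp
    show "AE \<omega> in M. 0 \<le> i \<omega> * gap (xh k \<omega>) + curvature_rate * (i \<omega> * curv k \<omega> ^ 3)"
      using nonneg mult_nonneg_nonneg[OF less_imp_le[OF curvature_rate_pos] nonneg(2)]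
      by (intro AE_I2 add_nonneg_nonneg)
  qed
  also have "\<dots> \<le> ennreal ((\<integral>\<omega>. gap (x k \<omega>) \<partial>M) + \<beta> * (\<sigma> k)\<^sup>2)"
    by (rule ennreal_leI[OF le])
  finally show ?thesis .
qed

lemma curvature_step_decrease:
  assumes gap_int: "integrable M (\<lambda>\<omega>. gap (x k \<omega>))"
  shows "integrable M (\<lambda>\<omega>. gap (xh k \<omega>))" "integrable M (\<lambda>\<omega>. curv k \<omega> ^ 3)"
    "(\<integral>\<omega>. gap (xh k \<omega>) \<partial>M) + curvature_rate * (\<integral>\<omega>. curv k \<omega> ^ 3 \<partial>M)
      \<le> (\<integral>\<omega>. gap (x k \<omega>) \<partial>M) + \<beta> * (\<sigma> k)\<^sup>2"
proof -
  interpret finite_measure_subalgebra M "history k" by (rule subalgebra_history)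
  let ?U = "\<lambda>\<omega>. gap (xh k \<omega>) + curvature_rate * curv k \<omega> ^ 3"
  have nonneg: "0 \<le> gap (xh k \<omega>)" "0 \<le> curvature_rate * curv k \<omega> ^ 3" for \<omega>
    using curvature_rate_pos curv_nonneg[of k \<omega>] bounded_below by auto
  have bound: "(\<integral>\<^sup>+\<omega>. ennreal (?U \<omega>) \<partial>M) \<le> ennreal ((\<integral>\<omega>. gap (x k \<omega>) \<partial>M) + \<beta> * (\<sigma> k)\<^sup>2)"
  proof (rule nn_integral_le_by_localization)
    show "AE \<omega> in M. nn_cond_exp M (history k) (\<lambda>\<omega>. ennreal ((norm (p k \<omega>))\<^sup>2)) \<omega> < \<infinity>"
      using B_hessian[of k] unfolding Let_def by eventually_elim simp
  qed (measurable, rule curvature_step_on[OF _ _ gap_int])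
  have U_int: "integrable M ?U"
  proof (rule integrableI_nonneg)
    show "AE \<omega> in M. 0 \<le> ?U \<omega>"
      using nonneg by (intro AE_I2 add_nonneg_nonneg)
    show "(\<integral>\<^sup>+\<omega>. ennreal (?U \<omega>) \<partial>M) < \<infinity>"
      using bound by (rule le_less_trans) simp
  qed measurable
  show int1: "integrable M (\<lambda>\<omega>. gap (xh k \<omega>))"
  proof (rule Bochner_Integration.integrable_bound[OF U_int])
    show "AE \<omega> in M. norm (gap (xh k \<omega>)) \<le> norm (?U \<omega>)"
    proof (rule AE_I2)
      fix \<omega> show "norm (gap (xh k \<omega>)) \<le> norm (?U \<omega>)"
        using nonneg[of \<omega>] by simp
    qed
  qed measurable
  have "integrable M (\<lambda>\<omega>. ?U \<omega> - gap (xh k \<omega>))"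
    by (rule Bochner_Integration.integrable_diff[OF U_int int1])
  then show int2: "integrable M (\<lambda>\<omega>. curv k \<omega> ^ 3)"
    using curvature_rate_pos by simp
  have "0 \<le> (\<integral>\<omega>. gap (x k \<omega>) \<partial>M) + \<beta> * (\<sigma> k)\<^sup>2"
    using \<beta>_pos gap_nonneg by (intro add_nonneg_nonneg Bochner_Integration.integral_nonneg) auto
  then have "(\<integral>\<omega>. ?U \<omega> \<partial>M) \<le> (\<integral>\<omega>. gap (x k \<omega>) \<partial>M) + \<beta> * (\<sigma> k)\<^sup>2"
    using bound nonneg U_int
    by (subst (asm) nn_integral_eq_integral) (auto simp: ennreal_le_iff intro!: add_nonneg_nonneg)
  then show "(\<integral>\<omega>. gap (xh k \<omega>) \<partial>M) + curvature_rate * (\<integral>\<omega>. curv k \<omega> ^ 3 \<partial>M)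
      \<le> (\<integral>\<omega>. gap (x k \<omega>) \<partial>M) + \<beta> * (\<sigma> k)\<^sup>2"
    using int1 int2 by simp
qed

section \<open>The gradient step\<close>

text \<open>
  With the error \<open>e = gh k - \<nabla>f(xh k)\<close>, the quadratic upper model contains \<open>e\<close> through
  \<open>\<nabla>f \<bullet> e\<close>, which has mean zero, and through \<open>\<parallel>e\<parallel>\<^sup>2\<close>, which condition (C) bounds. The bound on
  \<open>\<alpha>\<close> keeps the coefficient of \<open>\<parallel>\<nabla>f\<parallel>\<^sup>2\<close> at most \<open>- \<alpha> / 2\<close>.
\<close>

lemma gradient_step_decrease:
  assumes gap_int: "integrable M (\<lambda>\<omega>. gap (xh k \<omega>))"
  shows "integrable M (\<lambda>\<omega>. gap (x (Suc k) \<omega>))" "integrable M (\<lambda>\<omega>. (norm (grad f (xh k \<omega>)))\<^sup>2)"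
    "(\<integral>\<omega>. gap (x (Suc k) \<omega>) \<partial>M) + \<alpha> / 2 * (\<integral>\<omega>. (norm (grad f (xh k \<omega>)))\<^sup>2 \<partial>M)
      \<le> (\<integral>\<omega>. gap (xh k \<omega>) \<partial>M) + L\<^sub>g * \<alpha>\<^sup>2 / 2 * (\<sigma>h k)\<^sup>2"
proof -
  interpret finite_measure_subalgebra M "history_trial k" by (rule subalgebra_history_trial)
  define G where "G \<omega> = grad f (xh k \<omega>)" for \<omega>
  define e where "e \<omega> = gh k \<omega> - G \<omega>" for \<omega>
  have [measurable]: "G \<in> borel_measurable (history_trial k)" "G \<in> borel_measurable M" "e \<in> borel_measurable M"
    unfolding e_def[abs_def] G_def[abs_def] by measurable
  have G_int: "integrable M (\<lambda>\<omega>. (norm (G \<omega>))\<^sup>2)"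
  proof (rule Bochner_Integration.integrable_bound)
    show "integrable M (\<lambda>\<omega>. 2 * L\<^sub>g * gap (xh k \<omega>))"
      using gap_int by (intro integrable_mult_right)
    show "AE \<omega> in M. norm ((norm (G \<omega>))\<^sup>2) \<le> norm (2 * L\<^sub>g * gap (xh k \<omega>))"
      unfolding G_def using norm_grad_sq_le abs_ge_self by (intro AE_I2) (force intro: order.trans)
  qed measurable
  then show "integrable M (\<lambda>\<omega>. (norm (grad f (xh k \<omega>)))\<^sup>2)"
    by (simp add: G_def)
  have bound_int: "integrable M (\<lambda>\<omega>. \<theta>h\<^sup>2 * (norm (G \<omega>))\<^sup>2 + (\<sigma>h k)\<^sup>2)"
    using G_int by simp
  have e_nn: "(\<integral>\<^sup>+\<omega>. ennreal ((norm (e \<omega>))\<^sup>2) \<partial>M) \<le> ennreal (\<integral>\<omega>. \<theta>h\<^sup>2 * (norm (G \<omega>))\<^sup>2 + (\<sigma>h k)\<^sup>2 \<partial>M)"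
  proof -
    have "(\<integral>\<^sup>+\<omega>. 1 * ennreal ((norm (e \<omega>))\<^sup>2) \<partial>M)
        \<le> (\<integral>\<^sup>+\<omega>. 1 * 0 * 0 \<partial>M) + (\<integral>\<^sup>+\<omega>. 1 * ennreal (\<theta>h\<^sup>2 * (norm (G \<omega>))\<^sup>2 + (\<sigma>h k)\<^sup>2) \<partial>M)"
    proof (rule nn_integral_le_of_nn_cond_exp_le)
      show "AE \<omega> in M. nn_cond_exp M (history_trial k) (\<lambda>\<omega>. ennreal ((norm (e \<omega>))\<^sup>2)) \<omega>
          \<le> 0 * nn_cond_exp M (history_trial k) (\<lambda>_. 0) \<omega> + ennreal (\<theta>h\<^sup>2 * (norm (G \<omega>))\<^sup>2 + (\<sigma>h k)\<^sup>2)"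
        using C_variance[of k] by (simp add: Let_def e_def G_def)
    qed measurable
    also have "\<dots> = ennreal (\<integral>\<omega>. \<theta>h\<^sup>2 * (norm (G \<omega>))\<^sup>2 + (\<sigma>h k)\<^sup>2 \<partial>M)"
      using bound_int by (simp add: nn_integral_eq_integral del: ennreal_plus)
    finally show ?thesis by simp
  qed
  have e_int: "integrable M (\<lambda>\<omega>. (norm (e \<omega>))\<^sup>2)"
    using e_nn by (intro integrableI_nonneg) (auto intro: le_less_trans)
  have e_mean: "(\<integral>\<omega>. (norm (e \<omega>))\<^sup>2 \<partial>M) \<le> \<theta>h\<^sup>2 * (\<integral>\<omega>. (norm (G \<omega>))\<^sup>2 \<partial>M) + (\<sigma>h k)\<^sup>2"
  proof -
    have "(\<integral>\<omega>. (norm (e \<omega>))\<^sup>2 \<partial>M) \<le> (\<integral>\<omega>. \<theta>h\<^sup>2 * (norm (G \<omega>))\<^sup>2 + (\<sigma>h k)\<^sup>2 \<partial>M)"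
      using e_nn e_int
      by (subst (asm) nn_integral_eq_integral)
        (auto simp: ennreal_le_iff intro!: Bochner_Integration.integral_nonneg)
    also have "\<dots> = \<theta>h\<^sup>2 * (\<integral>\<omega>. (norm (G \<omega>))\<^sup>2 \<partial>M) + (\<sigma>h k)\<^sup>2"
      using G_int by (simp add: prob_space)
    finally show ?thesis .
  qed
  have component_int: "integrable M (\<lambda>\<omega>. G \<omega> $ j * e \<omega> $ j)" for j
  proof (rule Bochner_Integration.integrable_bound)
    show "integrable M (\<lambda>\<omega>. (norm (G \<omega>))\<^sup>2 + (norm (e \<omega>))\<^sup>2)"
      using G_int e_int by simp
    show "AE \<omega> in M. norm (G \<omega> $ j * e \<omega> $ j) \<le> norm ((norm (G \<omega>))\<^sup>2 + (norm (e \<omega>))\<^sup>2)"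
    proof (rule AE_I2)
      fix \<omega>
      have "\<bar>G \<omega> $ j * e \<omega> $ j\<bar> \<le> norm (G \<omega>) * norm (e \<omega>)"
        unfolding abs_mult by (intro mult_mono component_le_norm_cart) auto
      also have "\<dots> \<le> (norm (G \<omega>))\<^sup>2 + (norm (e \<omega>))\<^sup>2"
        using sum_squares_bound[of "norm (G \<omega>)" "norm (e \<omega>)"]
          mult_nonneg_nonneg[OF norm_ge_zero[of "G \<omega>"] norm_ge_zero[of "e \<omega>"]]
        by linarith
      finally show "norm (G \<omega> $ j * e \<omega> $ j) \<le> norm ((norm (G \<omega>))\<^sup>2 + (norm (e \<omega>))\<^sup>2)" by simp
    qed
  qed measurable
  have G_sq_int: "integrable M (\<lambda>\<omega>. G \<omega> $ j * G \<omega> $ j)" for j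
  proof (rule Bochner_Integration.integrable_bound[OF G_int])
    show "AE \<omega> in M. norm (G \<omega> $ j * G \<omega> $ j) \<le> norm ((norm (G \<omega>))\<^sup>2)"
    proof (rule AE_I2)
      fix \<omega>
      have "\<bar>G \<omega> $ j\<bar> * \<bar>G \<omega> $ j\<bar> \<le> norm (G \<omega>) * norm (G \<omega>)"
        by (intro mult_mono component_le_norm_cart) auto
      then show "norm (G \<omega> $ j * G \<omega> $ j) \<le> norm ((norm (G \<omega>))\<^sup>2)"
        by (simp add: power2_eq_square)
    qed
  qed measurable
  \<comment> \<open>Unbiasedness is a statement on components; it is tested against the components of the trial gradient.\<close>
  have component_mean: "(\<integral>\<omega>. G \<omega> $ j * e \<omega> $ j \<partial>M) = 0" for j
  proof -
    have "G \<omega> $ j * gh k \<omega> $ j = G \<omega> $ j * e \<omega> $ j + G \<omega> $ j * G \<omega> $ j" for \<omega>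
      by (simp add: e_def algebra_simps)
    then have g_int: "integrable M (\<lambda>\<omega>. G \<omega> $ j * gh k \<omega> $ j)"
      and g_eq: "(\<integral>\<omega>. G \<omega> $ j * gh k \<omega> $ j \<partial>M) = (\<integral>\<omega>. G \<omega> $ j * e \<omega> $ j \<partial>M) + (\<integral>\<omega>. G \<omega> $ j * G \<omega> $ j \<partial>M)"
      using component_int[of j] G_sq_int[of j] by simp_all
    have "(\<integral>\<omega>. G \<omega> $ j * gh k \<omega> $ j \<partial>M)
        = (\<integral>\<omega>. G \<omega> $ j * real_cond_exp M (history_trial k) (\<lambda>\<omega>. gh k \<omega> $ j) \<omega> \<partial>M)"
      by (rule real_cond_exp_intg(2)[symmetric, OF g_int]) measurable
    also have "\<dots> = (\<integral>\<omega>. G \<omega> $ j * G \<omega> $ j \<partial>M)"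
    proof (rule integral_cong_AE)
      have rce: "real_cond_exp M (history_trial k) (\<lambda>\<omega>. gh k \<omega> $ j) \<in> borel_measurable M"
        by (rule measurable_from_subalg[OF subalg]) simp
      show "(\<lambda>\<omega>. G \<omega> $ j * real_cond_exp M (history_trial k) (\<lambda>\<omega>. gh k \<omega> $ j) \<omega>) \<in> borel_measurable M"
        using rce by measurable
      show "AE \<omega> in M. G \<omega> $ j * real_cond_exp M (history_trial k) (\<lambda>\<omega>. gh k \<omega> $ j) \<omega> = G \<omega> $ j * G \<omega> $ j"
        using C_unbiased[where k = k and i = j] unfolding Let_def by eventually_elim (simp add: G_def)
    qed measurable
    finally show ?thesis using g_eq by simp
  qed
  have inner_eq: "G \<omega> \<bullet> e \<omega> = (\<Sum>j\<in>UNIV. G \<omega> $ j * e \<omega> $ j)" for \<omega>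
    by (simp add: inner_vec_def)
  have Ge_int: "integrable M (\<lambda>\<omega>. G \<omega> \<bullet> e \<omega>)"
    unfolding inner_eq by (intro Bochner_Integration.integrable_sum component_int)
  have Ge_mean: "(\<integral>\<omega>. G \<omega> \<bullet> e \<omega> \<partial>M) = 0"
    unfolding inner_eq using component_int component_mean by (simp add: Bochner_Integration.integral_sum)

  define R where "R \<omega> = gap (xh k \<omega>) + (L\<^sub>g * \<alpha>\<^sup>2 / 2 - \<alpha>) * (norm (G \<omega>))\<^sup>2
      + (L\<^sub>g * \<alpha>\<^sup>2 - \<alpha>) * (G \<omega> \<bullet> e \<omega>) + L\<^sub>g * \<alpha>\<^sup>2 / 2 * (norm (e \<omega>))\<^sup>2" for \<omega>
  have R_int: "integrable M R"
    unfolding R_def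
    by (intro Bochner_Integration.integrable_add integrable_mult_right gap_int G_int Ge_int e_int)
  have pointwise: "gap (x (Suc k) \<omega>) \<le> R \<omega>" if \<omega>: "\<omega> \<in> space M" for \<omega>
  proof -
    have "f (x (Suc k) \<omega>) \<le> f (xh k \<omega>) - \<alpha> * (G \<omega> \<bullet> gh k \<omega>) + L\<^sub>g / 2 * (\<alpha>\<^sup>2 * (norm (gh k \<omega>))\<^sup>2)"
      using quadratic_upper_bound[of "xh k \<omega>" "- \<alpha> *\<^sub>R gh k \<omega>"]
      by (simp add: gradient_step[OF \<omega>] G_def power_mult_distrib)
    moreover have "gh k \<omega> = G \<omega> + e \<omega>"
      by (simp add: e_def)
    then have "G \<omega> \<bullet> gh k \<omega> = (norm (G \<omega>))\<^sup>2 + G \<omega> \<bullet> e \<omega>"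
      "(norm (gh k \<omega>))\<^sup>2 = (norm (G \<omega>))\<^sup>2 + 2 * (G \<omega> \<bullet> e \<omega>) + (norm (e \<omega>))\<^sup>2"
      by (simp_all add: power2_norm_eq_inner inner_add_left inner_add_right inner_commute)
    ultimately show ?thesis
      by (simp add: R_def algebra_simps add_divide_distrib)
  qed
  show int1: "integrable M (\<lambda>\<omega>. gap (x (Suc k) \<omega>))"
  proof (rule Bochner_Integration.integrable_bound[OF R_int])
    show "AE \<omega> in M. norm (gap (x (Suc k) \<omega>)) \<le> norm (R \<omega>)"
      using pointwise gap_nonneg[of "x (Suc k) _"] by (intro AE_I2) (force intro: order.trans[OF _ abs_ge_self])
  qed measurable
  have "(\<integral>\<omega>. gap (x (Suc k) \<omega>) \<partial>M) \<le> (\<integral>\<omega>. R \<omega> \<partial>M)"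
    by (rule integral_mono[OF int1 R_int pointwise])
  also have "\<dots> = (\<integral>\<omega>. gap (xh k \<omega>) \<partial>M) + (L\<^sub>g * \<alpha>\<^sup>2 / 2 - \<alpha>) * (\<integral>\<omega>. (norm (G \<omega>))\<^sup>2 \<partial>M)
      + L\<^sub>g * \<alpha>\<^sup>2 / 2 * (\<integral>\<omega>. (norm (e \<omega>))\<^sup>2 \<partial>M)"
    unfolding R_def using gap_int G_int Ge_int e_int
    by (simp add: Ge_mean del: Bochner_Integration.integral_diff)
  also have "\<dots> \<le> (\<integral>\<omega>. gap (xh k \<omega>) \<partial>M) + (L\<^sub>g * \<alpha>\<^sup>2 / 2 - \<alpha>) * (\<integral>\<omega>. (norm (G \<omega>))\<^sup>2 \<partial>M)
      + L\<^sub>g * \<alpha>\<^sup>2 / 2 * (\<theta>h\<^sup>2 * (\<integral>\<omega>. (norm (G \<omega>))\<^sup>2 \<partial>M) + (\<sigma>h k)\<^sup>2)"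
    using L\<^sub>g_pos by (intro add_left_mono mult_left_mono e_mean) auto
  also have "\<dots> = (\<integral>\<omega>. gap (xh k \<omega>) \<partial>M)
      + (L\<^sub>g * \<alpha>\<^sup>2 * (1 + \<theta>h\<^sup>2) / 2 - \<alpha>) * (\<integral>\<omega>. (norm (G \<omega>))\<^sup>2 \<partial>M) + L\<^sub>g * \<alpha>\<^sup>2 / 2 * (\<sigma>h k)\<^sup>2"
    by (simp add: algebra_simps add_divide_distrib)
  also have "\<dots> \<le> (\<integral>\<omega>. gap (xh k \<omega>) \<partial>M)
      + - (\<alpha> / 2) * (\<integral>\<omega>. (norm (G \<omega>))\<^sup>2 \<partial>M) + L\<^sub>g * \<alpha>\<^sup>2 / 2 * (\<sigma>h k)\<^sup>2"
  proof (intro add_right_mono add_left_mono mult_right_mono)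
    have "0 < L\<^sub>g * (1 + \<theta>h\<^sup>2)"
      using L\<^sub>g_pos by (intro mult_pos_pos add_pos_nonneg) auto
    then have "\<alpha> * (L\<^sub>g * (1 + \<theta>h\<^sup>2)) \<le> 1"
      using \<alpha>_le by (simp add: pos_le_divide_eq)
    from mult_left_mono[OF this, of \<alpha>] show "L\<^sub>g * \<alpha>\<^sup>2 * (1 + \<theta>h\<^sup>2) / 2 - \<alpha> \<le> - (\<alpha> / 2)"
      using \<alpha>_pos by (simp add: power2_eq_square algebra_simps)
  qed (auto intro!: Bochner_Integration.integral_nonneg)
  finally show "(\<integral>\<omega>. gap (x (Suc k) \<omega>) \<partial>M) + \<alpha> / 2 * (\<integral>\<omega>. (norm (grad f (xh k \<omega>)))\<^sup>2 \<partial>M)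
      \<le> (\<integral>\<omega>. gap (xh k \<omega>) \<partial>M) + L\<^sub>g * \<alpha>\<^sup>2 / 2 * (\<sigma>h k)\<^sup>2"
    by (simp add: G_def)
qed

section \<open>Convergence of the method\<close>

lemma integrable_gap: "integrable M (\<lambda>\<omega>. gap (x k \<omega>))"
proof (induction k)
  case 0
  have "integrable M (\<lambda>\<omega>. gap (x 0 \<omega>)) \<longleftrightarrow> integrable M (\<lambda>\<omega>. gap x0)"
    by (rule Bochner_Integration.integrable_cong) (simp_all add: initial)
  then show ?case by simp
next
  case (Suc k)
  then show ?case
    using curvature_step_decrease(1) gradient_step_decrease(1) by blast
qed

context
  assumes \<sigma>_summable: "summable (\<lambda>k. (\<sigma> k)\<^sup>2)" and \<sigma>h_summable: "summable (\<lambda>k. (\<sigma>h k)\<^sup>2)"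
begin

lemma summable_means:
  "summable (\<lambda>k. curvature_rate * (\<integral>\<omega>. curv k \<omega> ^ 3 \<partial>M)
    + \<alpha> / 2 * (\<integral>\<omega>. (norm (grad f (xh k \<omega>)))\<^sup>2 \<partial>M))"
proof (rule summable_of_descent)
  show "summable (\<lambda>k. \<beta> * (\<sigma> k)\<^sup>2 + L\<^sub>g * \<alpha>\<^sup>2 / 2 * (\<sigma>h k)\<^sup>2)"
    by (intro summable_add summable_mult \<sigma>_summable \<sigma>h_summable)
  fix k
  show "(\<integral>\<omega>. gap (x (Suc k) \<omega>) \<partial>M)
      + (curvature_rate * (\<integral>\<omega>. curv k \<omega> ^ 3 \<partial>M) + \<alpha> / 2 * (\<integral>\<omega>. (norm (grad f (xh k \<omega>)))\<^sup>2 \<partial>M))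
      \<le> (\<integral>\<omega>. gap (x k \<omega>) \<partial>M) + (\<beta> * (\<sigma> k)\<^sup>2 + L\<^sub>g * \<alpha>\<^sup>2 / 2 * (\<sigma>h k)\<^sup>2)"
    using curvature_step_decrease(3)[OF integrable_gap[of k]]
      gradient_step_decrease(3)[OF curvature_step_decrease(1)[OF integrable_gap[of k]]] by linarith
  show "0 \<le> (\<integral>\<omega>. gap (x k \<omega>) \<partial>M)"
    by (intro Bochner_Integration.integral_nonneg gap_nonneg)
  show "0 \<le> curvature_rate * (\<integral>\<omega>. curv k \<omega> ^ 3 \<partial>M) + \<alpha> / 2 * (\<integral>\<omega>. (norm (grad f (xh k \<omega>)))\<^sup>2 \<partial>M)"
    using curvature_rate_pos \<alpha>_pos curv_nonneg
    by (intro add_nonneg_nonneg mult_nonneg_nonneg Bochner_Integration.integral_nonneg) auto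
  show "0 \<le> \<beta> * (\<sigma> k)\<^sup>2 + L\<^sub>g * \<alpha>\<^sup>2 / 2 * (\<sigma>h k)\<^sup>2"
    using \<beta>_pos L\<^sub>g_pos by simp
qed

lemma mean_curv_and_trial_grad_tendsto_0:
  "(\<lambda>k. \<integral>\<omega>. curv k \<omega> \<partial>M) \<longlonglongrightarrow> 0" "(\<lambda>k. \<integral>\<omega>. norm (grad f (xh k \<omega>)) \<partial>M) \<longlonglongrightarrow> 0"
proof -
  let ?u = "\<lambda>k. \<integral>\<omega>. curv k \<omega> ^ 3 \<partial>M" and ?v = "\<lambda>k. \<integral>\<omega>. (norm (grad f (xh k \<omega>)))\<^sup>2 \<partial>M"
  have lim: "(\<lambda>k. curvature_rate * ?u k + \<alpha> / 2 * ?v k) \<longlonglongrightarrow> 0"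
    by (rule summable_LIMSEQ_zero[OF summable_means])
  have nonneg: "0 \<le> ?u k" "0 \<le> ?v k" for k
    using curv_nonneg by (auto intro!: Bochner_Integration.integral_nonneg)
  have "(\<lambda>k. curvature_rate * ?u k) \<longlonglongrightarrow> 0"
    by (rule tendsto_sandwich[OF _ _ tendsto_const lim])
      (use nonneg curvature_rate_pos \<alpha>_pos in \<open>auto intro!: always_eventually\<close>)
  from tendsto_mult[OF tendsto_const[of "1 / curvature_rate"] this] have u: "?u \<longlonglongrightarrow> 0"
    using curvature_rate_pos by simp
  have "(\<lambda>k. \<alpha> / 2 * ?v k) \<longlonglongrightarrow> 0"
    by (rule tendsto_sandwich[OF _ _ tendsto_const lim])
      (use nonneg curvature_rate_pos \<alpha>_pos in \<open>auto intro!: always_eventually\<close>)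
  from tendsto_mult[OF tendsto_const[of "2 / \<alpha>"] this] have v: "?v \<longlonglongrightarrow> 0"
    using \<alpha>_pos by simp
  show "(\<lambda>k. \<integral>\<omega>. curv k \<omega> \<partial>M) \<longlonglongrightarrow> 0"
    by (rule mean_tendsto_0_of_power_mean[OF _ curv_nonneg _
          curvature_step_decrease(2)[OF integrable_gap] u]) simp_all
  show "(\<lambda>k. \<integral>\<omega>. norm (grad f (xh k \<omega>)) \<partial>M) \<longlonglongrightarrow> 0"
    by (rule mean_tendsto_0_of_power_mean[OF _ norm_ge_zero _
          gradient_step_decrease(2)[OF curvature_step_decrease(1)[OF integrable_gap]] v]) simp_all
qed

lemma mean_grad_tendsto_0:
  "integrable M (\<lambda>\<omega>. norm (grad f (x k \<omega>)))" "(\<lambda>k. \<integral>\<omega>. norm (grad f (x k \<omega>)) \<partial>M) \<longlonglongrightarrow> 0"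
proof -
  have trial_int: "integrable M (\<lambda>\<omega>. norm (grad f (xh k \<omega>)))" for k
    by (rule integrable_of_integrable_power[OF _ norm_ge_zero _
          gradient_step_decrease(2)[OF curvature_step_decrease(1)[OF integrable_gap]]]) simp_all
  let ?B = "\<lambda>k \<omega>. norm (grad f (xh k \<omega>)) + L\<^sub>g * \<beta> * \<delta> * curv k \<omega>"
  have B_int: "integrable M (?B k)" for k
    using trial_int integrable_curv by simp
  have le: "norm (grad f (x k \<omega>)) \<le> ?B k \<omega>" if \<omega>: "\<omega> \<in> space M" for k \<omega>
  proof -
    have "norm (grad f (x k \<omega>)) \<le> norm (grad f (xh k \<omega>)) + norm (grad f (xh k \<omega>) - grad f (x k \<omega>))"
      using norm_triangle_sub[of "grad f (x k \<omega>)" "grad f (xh k \<omega>)"] by (simp add: norm_minus_commute)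
    also have "norm (grad f (xh k \<omega>) - grad f (x k \<omega>)) \<le> L\<^sub>g * norm (xh k \<omega> - x k \<omega>)"
      by (rule grad_diff)
    also have "norm (xh k \<omega> - x k \<omega>) = \<beta> * (\<delta> * curv k \<omega>)"
      using \<beta>_pos by (simp add: curvature_step[OF \<omega>] norm_p[OF \<omega>])
    finally show ?thesis by (simp add: mult.assoc)
  qed
  show int: "integrable M (\<lambda>\<omega>. norm (grad f (x k \<omega>)))" for k
  proof (rule Bochner_Integration.integrable_bound[OF B_int[of k]])
    show "AE \<omega> in M. norm (norm (grad f (x k \<omega>))) \<le> norm (?B k \<omega>)"
      using le[of _ k] by (intro AE_I2) (force intro: order.trans[OF _ abs_ge_self])
  qed measurable
  have upper: "(\<integral>\<omega>. norm (grad f (x k \<omega>)) \<partial>M)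
      \<le> (\<integral>\<omega>. norm (grad f (xh k \<omega>)) \<partial>M) + L\<^sub>g * \<beta> * \<delta> * (\<integral>\<omega>. curv k \<omega> \<partial>M)" for k
    using integral_mono[OF int B_int le, of k] trial_int[of k] integrable_curv[of k] by simp
  have "(\<lambda>k. (\<integral>\<omega>. norm (grad f (xh k \<omega>)) \<partial>M) + L\<^sub>g * \<beta> * \<delta> * (\<integral>\<omega>. curv k \<omega> \<partial>M)) \<longlonglongrightarrow> 0 + L\<^sub>g * \<beta> * \<delta> * 0"
    by (intro tendsto_intros mean_curv_and_trial_grad_tendsto_0)
  then have lim: "(\<lambda>k. (\<integral>\<omega>. norm (grad f (xh k \<omega>)) \<partial>M) + L\<^sub>g * \<beta> * \<delta> * (\<integral>\<omega>. curv k \<omega> \<partial>M)) \<longlonglongrightarrow> 0"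
    by simp
  show "(\<lambda>k. \<integral>\<omega>. norm (grad f (x k \<omega>)) \<partial>M) \<longlonglongrightarrow> 0"
    by (rule tendsto_sandwich[OF _ _ tendsto_const lim]) (auto intro!: always_eventually upper)
qed

lemma mean_min_eigenvalue_liminf:
  "integrable M (\<lambda>\<omega>. min_eigenvalue (hess f (x k \<omega>)))"
  "0 \<le> liminf (\<lambda>k. ereal (\<integral>\<omega>. min_eigenvalue (hess f (x k \<omega>)) \<partial>M))"
proof -
  show int: "integrable M (\<lambda>\<omega>. min_eigenvalue (hess f (x k \<omega>)))" for k
    by (rule integrable_const_bound[where B = L\<^sub>g]) (auto simp: abs_min_eigenvalue_hess_le)
  have lower: "- ((\<integral>\<omega>. curv k \<omega> \<partial>M) / (1 - \<gamma>\<^sub>l)) \<le> (\<integral>\<omega>. min_eigenvalue (hess f (x k \<omega>)) \<partial>M)" for k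
  proof -
    have "(1 - \<gamma>\<^sub>l) * (\<integral>\<omega>. neg_curv (x k \<omega>) \<partial>M) \<le> (\<integral>\<omega>. curv k \<omega> \<partial>M)"
      using mean_curv_lower_bound(1)[of "\<lambda>_. 1" k 1] by simp
    then have "(\<integral>\<omega>. neg_curv (x k \<omega>) \<partial>M) \<le> (\<integral>\<omega>. curv k \<omega> \<partial>M) / (1 - \<gamma>\<^sub>l)"
      using \<gamma>\<^sub>l_less by (simp add: pos_le_divide_eq mult.commute)
    moreover have "- (\<integral>\<omega>. neg_curv (x k \<omega>) \<partial>M) \<le> (\<integral>\<omega>. min_eigenvalue (hess f (x k \<omega>)) \<partial>M)"
      unfolding Bochner_Integration.integral_minus[symmetric]
      using integrable_neg_curv[of k] by (intro integral_mono int) (auto simp: neg_curv_def)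
    ultimately show ?thesis by linarith
  qed
  have "(\<lambda>k. - ((\<integral>\<omega>. curv k \<omega> \<partial>M) / (1 - \<gamma>\<^sub>l))) \<longlonglongrightarrow> - (0 / (1 - \<gamma>\<^sub>l))"
    using \<gamma>\<^sub>l_less by (intro tendsto_intros mean_curv_and_trial_grad_tendsto_0) auto
  then have "(\<lambda>k. ereal (- ((\<integral>\<omega>. curv k \<omega> \<partial>M) / (1 - \<gamma>\<^sub>l)))) \<longlonglongrightarrow> ereal 0"
    by simp
  then have "liminf (\<lambda>k. ereal (- ((\<integral>\<omega>. curv k \<omega> \<partial>M) / (1 - \<gamma>\<^sub>l)))) = 0"
    using lim_imp_Liminf[OF sequentially_bot] by (metis zero_ereal_def)
  moreover have "liminf (\<lambda>k. ereal (- ((\<integral>\<omega>. curv k \<omega> \<partial>M) / (1 - \<gamma>\<^sub>l))))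
      \<le> liminf (\<lambda>k. ereal (\<integral>\<omega>. min_eigenvalue (hess f (x k \<omega>)) \<partial>M))"
    using lower by (intro Liminf_mono always_eventually) simp
  ultimately show "0 \<le> liminf (\<lambda>k. ereal (\<integral>\<omega>. min_eigenvalue (hess f (x k \<omega>)) \<partial>M))"
    by simp
qed

end

end

theorem theorem3p12:
  fixes M :: "'a measure"
    and f :: "real^'n \<Rightarrow> real"
    and x0 :: "real^'n"
    and fbar L\<^sub>g L\<^sub>H \<alpha> \<beta> \<gamma> \<gamma>\<^sub>H \<gamma>\<^sub>l \<delta> \<theta> \<theta>h :: real
    and \<sigma> \<sigma>h :: "nat \<Rightarrow> real"
    and x xh p q g gh :: "nat \<Rightarrow> 'a \<Rightarrow> real^'n"
    and H :: "nat \<Rightarrow> 'a \<Rightarrow> real^'n^'n"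
  assumes C2: "twice_continuously_differentiable f"
    and L\<^sub>g_pos: "L\<^sub>g > 0" and L\<^sub>H_pos: "L\<^sub>H > 0"
    and grad_lipschitz: "L\<^sub>g-lipschitz_on UNIV (grad f)"
    and hess_lipschitz: "\<And>y z. onorm ((*v) (hess f y - hess f z)) \<le> L\<^sub>H * dist y z"
    and bounded_below: "\<And>y. fbar \<le> f y"
    and alg: "stochastic_two_step_method M f x0 (\<lambda>_. \<alpha>) (\<lambda>_. \<beta>) \<gamma> \<gamma>\<^sub>H \<gamma>\<^sub>l \<delta>
        (\<lambda>_. \<theta>) \<sigma> (\<lambda>_. \<theta>h) \<sigma>h x xh p q g gh H"
    and \<gamma>: "0 < \<gamma>" "\<gamma> \<le> 1"
    and \<gamma>\<^sub>H: "0 \<le> \<gamma>\<^sub>H" "\<gamma>\<^sub>H < \<gamma>"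
    and \<gamma>\<^sub>l: "0 \<le> \<gamma>\<^sub>l" "\<gamma>\<^sub>l < 1"
    and \<gamma>\<^sub>H_\<gamma>\<^sub>l: "\<gamma>\<^sub>H < \<gamma> * (1 - \<gamma>\<^sub>l)"
    and \<delta>: "0 < \<delta>"
    and \<theta>: "0 \<le> \<theta>" "\<theta> < 1"
    and \<theta>h: "0 \<le> \<theta>h"
    and \<sigma>_pos: "\<And>k. 0 < \<sigma> k" and \<sigma>h_pos: "\<And>k. 0 < \<sigma>h k"
    and \<sigma>_summable: "summable (\<lambda>k. (\<sigma> k)\<^sup>2)"
    and \<sigma>h_summable: "summable (\<lambda>k. (\<sigma>h k)\<^sup>2)"
    and \<alpha>: "0 < \<alpha>" "\<alpha> \<le> 1 / (L\<^sub>g * (1 + \<theta>h\<^sup>2))"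
    and \<beta>: "0 < \<beta>" "\<beta> \<le> 3 * (\<gamma> - \<gamma>\<^sub>H / (1 - \<gamma>\<^sub>l)) / (2 * \<delta> * L\<^sub>H)"
  shows "(\<forall>k. integrable M (\<lambda>\<omega>. norm (grad f (x k \<omega>)))) \<and>
      (\<lambda>k. \<integral>\<omega>. norm (grad f (x k \<omega>)) \<partial>M) \<longlonglongrightarrow> 0 \<and>
      (\<forall>k. integrable M (\<lambda>\<omega>. min_eigenvalue (hess f (x k \<omega>)))) \<and>
      0 \<le> liminf (\<lambda>k. ereal (\<integral>\<omega>. min_eigenvalue (hess f (x k \<omega>)) \<partial>M))"
proof -
  interpret two_step_constant_steps f L\<^sub>g L\<^sub>H fbar M x0 \<alpha> \<beta> \<gamma> \<gamma>\<^sub>H \<gamma>\<^sub>l \<delta> \<theta> \<theta>h \<sigma> \<sigma>h x xh p q g gh H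
    by (intro two_step_constant_steps.intro smooth_objective.intro
        two_step_constant_steps_axioms.intro assms)
  show ?thesis
    using mean_grad_tendsto_0[OF \<sigma>_summable \<sigma>h_summable]
      mean_min_eigenvalue_liminf[OF \<sigma>_summable \<sigma>h_summable] by blast
qed

end
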